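(* Let $\Omega\subset\mathbb{R}^d$ be bounded and open, $1<p,q<\infty$, and let $X\subset L_p(\Omega;\mathbb{R}^{m_1})\times L_q(\Omega;\mathbb{R}^{m_2})$ be weakly closed. Let $f,f_n:\Omega\times\mathbb{R}^{m_1}\times\mathbb{R}^{m_2}\to\mathbb{R}$ be Carathéodory functions and define $I^X_n(v)=\int_\Omega f_n(x,v(x))dx$ and $I^X(v)=\int_\Omega f(x,v(x))dx$ if $v\in X$, both $+\infty$ otherwise. Assume: (H1) for every bounded sequence $v_n\subset X$ there is a $(p,q)$-equi-integrable sequence $w_n\subset X$ with $w_n-v_n\to0$ in measure; (H2) there is $C>0$ with $0\le f_n(x,z_1,z_2),f(x,z_1,z_2)\le C(1+|z_1|^p+|z_2|^q)$ for all $n$, all $(z_1,z_2)$ and a.e. $x$; (H3) for every $R>0$ there is a monotone $\nu_R:[0,\infty)\to\mathbb{R}$ with $\nu_R(s)\to0$ as $s\to0$ such that for all $n$, all $z,z'\in\mathbb{R}^{m_1}\times\mathbb{R}^{m_2}$ with $|z|,|z'|\le R$ and a.e. $x$: $|f_n(x,z)-f_n(x,z')|+|f(x,z)-f(x,z')|<\nu_R(|z-z'|)$; (H4) for every $(p,q)$-equi-integrable set $B$ and every $\varepsilon>0$ there is $n_\varepsilon$ such that $|\int_\Omega f_n(x,v)-f(x,v)\,dx|\le\varepsilon$ for all $v\in B$ and $n\ge n_\varepsilon$. Then: (i) for all sequences $v_n\rightharpoonup v$ in $X$ there is $w_n\rightharpoonup v$ in $X$ with $\limsup_n I^X_n(w_n)\le\liminf_n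 I^X(v_n)$; (ii) for all $v_n\rightharpoonup v$ in $X$ there is $\bar w_n\rightharpoonup v$ in $X$ with $\limsup_n I^X(\bar w_n)\le\liminf_n I^X_n(v_n)$; (iii) if the sequential $\Gamma$-limit (in the weak topology) of the constant sequence $I^X$ exists, then the sequential $\Gamma$-limit of $(I^X_n)$ exists and coincides with it.
   Context: Carathéodory: measurable in $x$, continuous in $z$. A set $X\subset L_p(\Omega;\mathbb{R}^{m_1})\times L_q(\Omega;\mathbb{R}^{m_2})$ is $(p,q)$-equi-integrable if for every $\varepsilon>0$ there is $\delta>0$ such that $|E|<\delta$ implies $\sup_{(v_1,v_2)\in X}\int_E|v_1|^p+|v_2|^q\,dx<\varepsilon$. Sequential $\Gamma$-convergence of $G_n$ to $G$ in the weak topology: for every $v$ and every $v_n\rightharpoonup v$, $G(v)\le\liminf G_n(v_n)$, and for every $v$ there is $v_n\rightharpoonup v$ with $G(v)\ge\limsup G_n(v_n)$. *)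

theory Defs
  imports "HOL-Analysis.Analysis"
begin

text \<open>L_p(Omega; R^m): Lebesgue measurable functions on Omega with integrable p-th power of the norm.
  Functions are not quotiented by a.e. equality; the weak topology below does not distinguish
  a.e.-equal functions, so weakly closed sets are automatically saturated.\<close>
definition Lp_space :: "'d::euclidean_space set \<Rightarrow> real \<Rightarrow> ('d \<Rightarrow> 'a::euclidean_space) set" where
  "Lp_space \<Omega> p = {u. u \<in> borel_measurable (lebesgue_on \<Omega>) \<and>
      integrable (lebesgue_on \<Omega>) (\<lambda>x. norm (u x) powr p)}"

definition Lpq_space :: "'d::euclidean_space set \<Rightarrow> real \<Rightarrow> real \<Rightarrow>
    ('d \<Rightarrow> 'a::euclidean_space \<times> 'b::euclidean_space) set" where
  "Lpq_space \<Omega> p q = {v. (\<lambda>x. fst (v x)) \<in> Lp_space \<Omega> p \<and> (\<lambda>x. snd (v x)) \<in> Lp_space \<Omega> q}"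

definition weak_top :: "'d::euclidean_space set \<Rightarrow> real \<Rightarrow> real \<Rightarrow>
    ('d \<Rightarrow> 'a::euclidean_space \<times> 'b::euclidean_space) topology" where
  "weak_top \<Omega> p q = topology_generated_by
     {{v \<in> Lpq_space \<Omega> p q.
        (\<integral>x. g1 x \<bullet> fst (v x) + g2 x \<bullet> snd (v x) \<partial>(lebesgue_on \<Omega>)) \<in> U} | g1 g2 U.
        g1 \<in> Lp_space \<Omega> (p / (p - 1)) \<and> g2 \<in> Lp_space \<Omega> (q / (q - 1)) \<and> open U}"

definition weakly_closed :: "'d::euclidean_space set \<Rightarrow> real \<Rightarrow> real \<Rightarrow>
    ('d \<Rightarrow> 'a::euclidean_space \<times> 'b::euclidean_space) set \<Rightarrow> bool" where
  "weakly_closed \<Omega> p q X \<longleftrightarrow> closedin (weak_top \<Omega> p q) X"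

definition weak_conv :: "'d::euclidean_space set \<Rightarrow> real \<Rightarrow> real \<Rightarrow>
    (nat \<Rightarrow> 'd \<Rightarrow> 'a::euclidean_space \<times> 'b::euclidean_space) \<Rightarrow> ('d \<Rightarrow> 'a \<times> 'b) \<Rightarrow> bool" where
  "weak_conv \<Omega> p q vs v \<longleftrightarrow> (\<forall>n. vs n \<in> Lpq_space \<Omega> p q) \<and> limitin (weak_top \<Omega> p q) vs v sequentially"

definition bounded_seq :: "'d::euclidean_space set \<Rightarrow> real \<Rightarrow> real \<Rightarrow>
    (nat \<Rightarrow> 'd \<Rightarrow> 'a::euclidean_space \<times> 'b::euclidean_space) \<Rightarrow> bool" where
  "bounded_seq \<Omega> p q vs \<longleftrightarrow> (\<forall>n. vs n \<in> Lpq_space \<Omega> p q) \<and>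
     (\<exists>M. \<forall>n. (\<integral>x. norm (fst (vs n x)) powr p \<partial>(lebesgue_on \<Omega>)) \<le> M \<and>
              (\<integral>x. norm (snd (vs n x)) powr q \<partial>(lebesgue_on \<Omega>)) \<le> M)"

definition equi_integrable :: "'d::euclidean_space set \<Rightarrow> real \<Rightarrow> real \<Rightarrow>
    ('d \<Rightarrow> 'a::euclidean_space \<times> 'b::euclidean_space) set \<Rightarrow> bool" where
  "equi_integrable \<Omega> p q B \<longleftrightarrow> B \<subseteq> Lpq_space \<Omega> p q \<and>
     (\<forall>\<epsilon>>0. \<exists>\<delta>>0. \<forall>E. E \<subseteq> \<Omega> \<and> E \<in> sets lebesgue \<and> measure lebesgue E < \<delta> \<longrightarrow>
        (\<forall>v\<in>B. (\<integral>x. norm (fst (v x)) powr p + norm (snd (v x)) powr q \<partial>(lebesgue_on E)) < \<epsilon>))"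

definition to_zero_in_measure :: "'d::euclidean_space set \<Rightarrow> (nat \<Rightarrow> 'd \<Rightarrow> 'c::real_normed_vector) \<Rightarrow> bool" where
  "to_zero_in_measure \<Omega> us \<longleftrightarrow>
     (\<forall>\<epsilon>>0. ((\<lambda>n. emeasure lebesgue {x\<in>\<Omega>. \<epsilon> < norm (us n x)}) \<longlongrightarrow> 0) sequentially)"

definition caratheodory :: "'d::euclidean_space set \<Rightarrow> ('d \<Rightarrow> 'c::euclidean_space \<Rightarrow> real) \<Rightarrow> bool" where
  "caratheodory \<Omega> f \<longleftrightarrow> (\<forall>z. (\<lambda>x. f x z) \<in> borel_measurable (lebesgue_on \<Omega>)) \<and>
     (\<forall>x\<in>\<Omega>. continuous_on UNIV (f x))"

definition IX :: "'d::euclidean_space set \<Rightarrow> ('d \<Rightarrow> 'a::euclidean_space \<times> 'b::euclidean_space \<Rightarrow> real) \<Rightarrow>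
    ('d \<Rightarrow> 'a \<times> 'b) set \<Rightarrow> ('d \<Rightarrow> 'a \<times> 'b) \<Rightarrow> ereal" where
  "IX \<Omega> f X v = (if v \<in> X then ereal (\<integral>x. f x (v x) \<partial>(lebesgue_on \<Omega>)) else \<infinity>)"

definition gamma_limit :: "'d::euclidean_space set \<Rightarrow> real \<Rightarrow> real \<Rightarrow>
    (nat \<Rightarrow> ('d \<Rightarrow> 'a::euclidean_space \<times> 'b::euclidean_space) \<Rightarrow> ereal) \<Rightarrow> (('d \<Rightarrow> 'a \<times> 'b) \<Rightarrow> ereal) \<Rightarrow> bool" where
  "gamma_limit \<Omega> p q Gs G \<longleftrightarrow>
     (\<forall>v\<in>Lpq_space \<Omega> p q. \<forall>vs. weak_conv \<Omega> p q vs v \<longrightarrow> G v \<le> liminf (\<lambda>n. Gs n (vs n))) \<and>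
     (\<forall>v\<in>Lpq_space \<Omega> p q. \<exists>vs. weak_conv \<Omega> p q vs v \<and> limsup (\<lambda>n. Gs n (vs n)) \<le> G v)"

end

theory Submission
  imports Defs
begin

text \<open>A weakly convergent sequence \<open>vs\<close> in \<open>X\<close> is bounded (uniform boundedness), so (H1) replaces it by an
  equi-integrable sequence \<open>ws\<close> in \<open>X\<close> with \<open>ws - vs\<close> tending to zero in measure; then \<open>ws\<close> has the
  same weak limit. By (H2), (H3) and equi-integrability, passing from \<open>vs\<close> to \<open>ws\<close> raises the integral of
  \<open>f\<close> or of \<open>fn n\<close> by at most \<open>o(1)\<close>, and on the equi-integrable set \<open>range ws\<close> (H4) allows \<open>f\<close> and
  \<open>fn n\<close> to be exchanged. Applied along a subsequence realising the lower limit this gives (i) and (ii).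
  For (iii), a sequence of finite lower or upper limit lies in \<open>X\<close> along a subsequence or tail, where
  (ii) yields the liminf inequality and (i) the recovery sequence.\<close>

subsection \<open>Weakly bounded sequences in Lebesgue spaces\<close>

text \<open>Three points shape the argument. Functions are not identified when they agree almost
  everywhere, so the uniform boundedness step is carried out on functions directly by a gliding
  hump: an unbounded sequence is tested against one explicit series of dual functions along which
  the pairings diverge. Next, (H2) and (H3) provide a null set for each fixed argument, whereas the
  integrands are evaluated at varying functions; continuity in the second variable merges these null
  sets over a countable dense set. A monotone \<open>\<nu>\<close> may jump, so it is replaced by a
  constant bound \<open>\<omega>\<close> on a range of distances before that merging. Finally, (H4)
  is uniform over \<open>range ws\<close>, so the index of the integrand and that of the sequence
  are independent; this lets a sequence built from a subsequence be renumbered and paired with every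
  \<open>fn n\<close>.\<close>

lemma Youngs_inequality_scaled:
  fixes p :: real
  assumes "1 < p" "0 < \<eta>" "0 \<le> a" "0 \<le> b"
  shows "a * b \<le> (a / \<eta>) powr (p / (p - 1)) + (\<eta> * b) powr p"
proof -
  have "a * b = (a / \<eta>) * (\<eta> * b)" using assms by simp
  also have "\<dots> \<le> (a / \<eta>) powr (p / (p - 1)) / (p / (p - 1)) + (\<eta> * b) powr p / p"
    using assms by (intro Youngs_inequality) (auto simp: field_simps)
  also have "\<dots> \<le> (a / \<eta>) powr (p / (p - 1)) / 1 + (\<eta> * b) powr p / 1"
    using assms by (intro add_mono divide_left_mono) (auto simp: field_simps)
  finally show ?thesis by simp
qed

lemma integrable_inner_conjugate:
  fixes g u :: "'x \<Rightarrow> 'a::euclidean_space"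
  assumes "1 < p"
    and [measurable]: "g \<in> borel_measurable M" "u \<in> borel_measurable M"
    and ig: "integrable M (\<lambda>x. norm (g x) powr (p / (p - 1)))"
    and iu: "integrable M (\<lambda>x. norm (u x) powr p)"
  shows "integrable M (\<lambda>x. norm (g x) * norm (u x))" "integrable M (\<lambda>x. g x \<bullet> u x)"
proof -
  show *: "integrable M (\<lambda>x. norm (g x) * norm (u x))"
    by (rule Bochner_Integration.integrable_bound[OF Bochner_Integration.integrable_add[OF ig iu]])
      (use Youngs_inequality_scaled[OF \<open>1 < p\<close>, of 1] in auto)
  show "integrable M (\<lambda>x. g x \<bullet> u x)"
    by (rule Bochner_Integration.integrable_bound[OF *]) (auto simp: Cauchy_Schwarz_ineq2)
qed

text \<open>By Tonelli the sum has a finite integral, hence is finite almost everywhere.\<close>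

lemma AE_summable_of_summable_integrals:
  fixes f :: "nat \<Rightarrow> 'x \<Rightarrow> real"
  assumes int: "\<And>i. integrable M (f i)" and nonneg: "\<And>i x. 0 \<le> f i x"
    and sum: "summable (\<lambda>i. integral\<^sup>L M (f i))"
  shows "AE x in M. summable (\<lambda>i. f i x)"
proof -
  have [measurable]: "f i \<in> borel_measurable M" for i using int by blast
  have "(\<integral>\<^sup>+x. (\<Sum>i. ennreal (f i x)) \<partial>M) = (\<Sum>i. \<integral>\<^sup>+x. ennreal (f i x) \<partial>M)"
    by (intro nn_integral_suminf) auto
  also have "\<dots> = (\<Sum>i. ennreal (integral\<^sup>L M (f i)))"
    by (intro arg_cong[where f=suminf] ext nn_integral_eq_integral int) (auto simp: nonneg)
  also have "\<dots> \<noteq> \<infinity>"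
    unfolding infinity_ennreal_def by (rule ennreal_suminf_neq_top[OF sum]) (simp add: nonneg)
  finally have "AE x in M. (\<Sum>i. ennreal (f i x)) \<noteq> \<infinity>"
    by (intro nn_integral_noteq_infinite) auto
  then show ?thesis
    by eventually_elim (auto intro!: summable_suminf_not_top nonneg)
qed

text \<open>Sokal's choice of signs: a sign that agrees with the preceding partial sum keeps the \<open>k\<close>-th
  functional large, and the geometric weights make the remaining tail too small to cancel it.\<close>
lemma gliding_hump_signs:
  fixes t :: "nat \<Rightarrow> nat \<Rightarrow> real"
  assumes t: "\<And>k j. \<bar>t k j\<bar> \<le> t k k"
  obtains s where "\<And>j. \<bar>s j\<bar> = (1::real)"
    and "\<And>k. (1/3)^k * t k k / 2 \<le> \<bar>\<Sum>j. (1/3)^j * s j * t k j\<bar>"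
proof -
  define s where "s = wfrec less_than (\<lambda>s k. if 0 \<le> (\<Sum>j<k. (1/3)^j * s j * t k j) then 1 else - 1)"
  have s: "s k = (if 0 \<le> (\<Sum>j<k. (1/3)^j * s j * t k j) then 1 else - 1)" for k
    unfolding s_def by (subst wfrec) (auto simp: cut_def intro!: if_cong sum.cong arg_cong[where f="\<lambda>y. 0 \<le> y"])
  have abs_s: "\<bar>s j\<bar> = 1" for j by (subst s) auto
  have geom: "summable (\<lambda>j. (1/3::real)^j)" by (intro summable_geometric) auto
  have "(1/3)^k * t k k / 2 \<le> \<bar>\<Sum>j. (1/3)^j * s j * t k j\<bar>" for k
  proof -
    let ?f = "\<lambda>j. (1/3)^j * s j * t k j"
    have bound: "\<bar>?f j\<bar> \<le> t k k * (1/3)^j" for j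
      using t[of k j] by (simp add: abs_mult abs_s mult.commute mult_left_mono)
    have sf: "summable ?f"
      by (rule summable_comparison_test'[of "\<lambda>j. t k k * (1/3)^j" 0])
        (use bound geom in \<open>auto intro: summable_mult\<close>)
    have "(\<Sum>j. ?f j) = (\<Sum>j. ?f (j + Suc k)) + (\<Sum>j<Suc k. ?f j)"
      by (rule suminf_split_initial_segment[OF sf])
    \<comment> \<open>The weights after the \<open>k\<close>-th sum to \<open>(1/3)^k / 2\<close>,
      half of the \<open>k\<close>-th weight, so the tail can cancel at most half of the
      hump.\<close>
    moreover have "\<bar>\<Sum>j. ?f (j + Suc k)\<bar> \<le> (1/3)^k * t k k / 2"
    proof -
      have "\<bar>\<Sum>j. ?f (j + Suc k)\<bar> \<le> (\<Sum>j. t k k * (1/3)^(j + Suc k))"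
        using bound norm_suminf_le[of "\<lambda>j. ?f (j + Suc k)" "\<lambda>j. t k k * (1/3)^(j + Suc k)",
            OF _ summable_mult[OF summable_ignore_initial_segment[OF geom]]]
        unfolding real_norm_def by blast
      also have "\<dots> = (\<Sum>j. (t k k * (1/3)^Suc k) * (1/3)^j)"
        by (simp add: power_add mult_ac)
      also have "\<dots> = t k k * (1/3)^Suc k * (3/2)"
        by (subst suminf_mult) (auto simp: suminf_geometric summable_geometric)
      finally show ?thesis by (simp add: mult_ac)
    qed
    moreover have "(1/3)^k * t k k \<le> \<bar>\<Sum>j<Suc k. ?f j\<bar>"
    proof -
      have "0 \<le> (1/3)^k * t k k" using t[of k k] by simp
      then show ?thesis
        by (cases "0 \<le> (\<Sum>j<k. ?f j)") (simp_all add: s[of k])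
    qed
    ultimately show ?thesis by linarith
  qed
  with abs_s that show ?thesis by blast
qed

text \<open>Uniform boundedness by contradiction. Terms of rapidly growing norm are selected, each
  is given a dual function of unit norm that attains its norm, and a signed geometric series
  \<open>g\<close> of these dual functions lies in the conjugate space while its pairings with the
  selected terms are unbounded.\<close>

lemma weakly_bounded_imp_bounded_Lp:
  fixes vs :: "nat \<Rightarrow> 'x \<Rightarrow> 'a::euclidean_space"
  assumes p: "1 < p"
    and meas: "\<And>n. vs n \<in> borel_measurable M"
    and int: "\<And>n. integrable M (\<lambda>x. norm (vs n x) powr p)"
    and weak: "\<And>g. g \<in> borel_measurable M \<Longrightarrow> integrable M (\<lambda>x. norm (g x) powr (p / (p - 1))) \<Longrightarrow>
      Bseq (\<lambda>n. \<integral>x. g x \<bullet> vs n x \<partial>M)"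
  shows "\<exists>K. \<forall>n. (\<integral>x. norm (vs n x) powr p \<partial>M) \<le> K"
proof (rule ccontr)
  assume "\<not> ?thesis"
  \<comment> \<open>The rate 6 is chosen against the weights \<open>(1/3)^k\<close> of the series: a
    factor \<open>2^k\<close> survives.\<close>
  then have "\<exists>n. (6 ^ k) powr p < (\<integral>x. norm (vs n x) powr p \<partial>M)" for k :: nat
    by (auto simp: not_le)
  then obtain m where m: "\<And>k::nat. (6 ^ k) powr p < (\<integral>x. norm (vs (m k) x) powr p \<partial>M)" by metis
  define V where "V k = vs (m k)" for k
  define N where "N k = (\<integral>x. norm (V k x) powr p \<partial>M) powr (1 / p)" for k
  define r where "r = p / (p - 1)"
  have r: "1 < r" "(p - 1) * r = p" "1 / r + 1 / p = 1" using p by (auto simp: r_def field_simps)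
  have [measurable]: "V k \<in> borel_measurable M" for k using meas by (simp add: V_def)
  have intV: "integrable M (\<lambda>x. norm (V k x) powr p)" for k using int by (simp add: V_def)
  have Nk: "6 ^ k < N k" for k
  proof -
    have "((6 ^ k) powr p) powr (1 / p) < N k"
      unfolding N_def V_def using m[of k] p by (intro powr_less_mono2) auto
    then show ?thesis using p by (simp add: powr_powr)
  qed
  then have N0: "0 < N k" for k by (meson less_trans zero_less_power zero_less_numeral)
  have Np: "(\<integral>x. norm (V k x) powr p \<partial>M) = N k powr p" for k
    unfolding N_def using p m[of k] by (simp add: powr_powr V_def)
  \<comment> \<open>This is the duality map of \<open>L_p\<close> at \<open>V k\<close>, scaled so
    that \<open>h k\<close> has unit norm in the conjugate space and pairs with \<open>V k\<close>
    to \<open>N k\<close>. Since \<open>0 powr a = 0\<close>, a negative exponent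
    \<open>p - 2\<close> does no harm where \<open>V k\<close> vanishes.\<close>
  define h where "h k x = (N k powr (1 - p) * norm (V k x) powr (p - 2)) *\<^sub>R V k x" for k x
  have [measurable]: "h k \<in> borel_measurable M" for k unfolding h_def by measurable
  have powr_step: "y powr (p - 2) * y = y powr (p - 1)" if "0 \<le> y" for y :: real
    using powr_add[of y "p - 2" 1] that by simp
  have norm_h: "norm (h k x) = N k powr (1 - p) * norm (V k x) powr (p - 1)" for k x
    by (simp add: h_def powr_step mult.assoc)
  have norm_hr: "norm (h k x) powr r = N k powr (- p) * norm (V k x) powr p" for k x
  proof -
    have "(1 - p) * r = - p" using r(2) by (simp add: algebra_simps)
    then show ?thesis by (simp add: norm_h powr_mult powr_powr r(2))
  qed
  have int_hr: "integrable M (\<lambda>x. norm (h k x) powr r)" for k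
    unfolding norm_hr using intV by simp
  have integral_hr: "(\<integral>x. norm (h k x) powr r \<partial>M) = 1" for k
    unfolding norm_hr using N0[of k] by (simp add: Np powr_minus)
  have int_hV: "integrable M (\<lambda>x. norm (h j x) * norm (V k x))" "integrable M (\<lambda>x. h j x \<bullet> V k x)" for j k
    using integrable_inner_conjugate[OF p, of "h j" M "V k"] int_hr[of j] intV[of k]
    by (auto simp: r_def)
  \<comment> \<open>Hoelder's inequality for \<open>h j\<close> of unit norm: Young's inequality for
    \<open>h j\<close> and \<open>V k / N k\<close> integrates to \<open>1 / r + 1 / p = 1\<close>.
    It supplies the domination of \<open>t k j\<close> by the diagonal that the choice of signs
    requires.\<close>
  have hV_le: "(\<integral>x. norm (h j x) * norm (V k x) \<partial>M) \<le> N k" for j k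
  proof -
    have "norm (h j x) * norm (V k x) \<le> N k * (norm (h j x) powr r / r + N k powr (- p) * norm (V k x) powr p / p)" for x
    proof -
      have "norm (h j x) * (norm (V k x) / N k) \<le> norm (h j x) powr r / r + (norm (V k x) / N k) powr p / p"
        using p r N0[of k] by (intro Youngs_inequality) auto
      then have "norm (h j x) * norm (V k x) \<le> N k * (norm (h j x) powr r / r + (norm (V k x) / N k) powr p / p)"
        using N0[of k] by (simp add: field_simps)
      then show ?thesis using N0[of k] by (simp add: powr_divide powr_minus field_simps)
    qed
    then have "(\<integral>x. norm (h j x) * norm (V k x) \<partial>M) \<le>
        (\<integral>x. N k * (norm (h j x) powr r / r + N k powr (- p) * norm (V k x) powr p / p) \<partial>M)"
      by (intro integral_mono int_hV) (auto intro!: Bochner_Integration.integrable_add int_hr intV)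
    also have "\<dots> = N k * (1 / r + N k powr (- p) * N k powr p / p)"
      by (simp add: int_hr intV integral_hr Np)
    also have "\<dots> = N k" using r N0[of k] by (simp add: powr_minus)
    finally show ?thesis .
  qed
  define t where "t k j = (\<integral>x. h j x \<bullet> V k x \<partial>M)" for k j
  have tkk: "t k k = N k" for k
  proof -
    have "h k x \<bullet> V k x = N k powr (1 - p) * norm (V k x) powr p" for x
    proof -
      have "h k x \<bullet> V k x = N k powr (1 - p) * (norm (V k x) powr (p - 2) * norm (V k x) * norm (V k x))"
        by (simp add: h_def dot_square_norm power2_eq_square)
      also have "norm (V k x) powr (p - 2) * norm (V k x) * norm (V k x) = norm (V k x) powr p"
        using powr_add[of "norm (V k x)" "p - 1" 1] by (simp add: powr_step)
      finally show ?thesis .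
    qed
    then have "t k k = N k powr (1 - p) * N k powr p" by (simp add: t_def Np)
    also have "\<dots> = N k" using N0[of k] by (simp flip: powr_add)
    finally show ?thesis .
  qed
  have "\<bar>t k j\<bar> \<le> t k k" for k j
  proof -
    have "\<bar>t k j\<bar> \<le> (\<integral>x. norm (h j x) * norm (V k x) \<partial>M)"
      unfolding t_def
      by (rule order_trans[OF integral_abs_bound integral_mono]) (use int_hV in \<open>auto simp: Cauchy_Schwarz_ineq2\<close>)
    with hV_le[of j k] tkk show ?thesis by simp
  qed
  then obtain s where s: "\<And>j. \<bar>s j\<bar> = (1::real)"
    and hump: "\<And>k. (1/3)^k * t k k / 2 \<le> \<bar>\<Sum>j. (1/3)^j * s j * t k j\<bar>"
    using gliding_hump_signs by metis
  define g where "g x = (\<Sum>j. ((1/3)^j * s j) *\<^sub>R h j x)" for x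
  \<comment> \<open>\<open>B\<close> serves as an integrable majorant for \<open>g\<close>.
    Splitting 1/3 as 2/3 times 1/2 bounds the \<open>j\<close>-th term of the series by
    \<open>(2/3)^j * B x powr (1 / r)\<close>, because a single summand of \<open>B\<close> is at
    most \<open>B\<close>. Summing gives \<open>norm (g x) \<le> 3 * B x powr (1 / r)\<close>, so
    \<open>g\<close> is in the conjugate space.\<close>
  define B where "B x = (\<Sum>j. (1/2)^j * norm (h j x) powr r)" for x
  have [measurable]: "g \<in> borel_measurable M" unfolding g_def by measurable
  have "summable (\<lambda>j. \<integral>x. (1/2)^j * norm (h j x) powr r \<partial>M)"
    by (simp add: integral_hr summable_geometric)
  note B_sum = AE_summable_of_summable_integrals[OF _ _ this]
  have AE_B: "AE x in M. summable (\<lambda>j. (1/2)^j * norm (h j x) powr r)"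
    by (rule B_sum) (auto simp: int_hr)
  have int_B: "integrable M B"
    unfolding B_def
    by (rule integrable_suminf)
      (use AE_B in \<open>auto simp: int_hr integral_hr summable_geometric\<close>)
  have AE_h: "AE x in M. summable (\<lambda>j. (1/3)^j * norm (h j x)) \<and> norm (g x) powr r \<le> 3 powr r * B x"
    using AE_B
  proof eventually_elim
    case (elim x)
    let ?b = "B x powr (1 / r)"
    have le: "(1/3)^j * norm (h j x) \<le> (2/3)^j * ?b" for j
    proof -
      have "((1/2)^j * norm (h j x)) powr r = ((1/2)^j) powr r * norm (h j x) powr r"
        by (simp add: powr_mult)
      also have "\<dots> \<le> ((1/2)^j) powr 1 * norm (h j x) powr r"
        using r by (intro mult_right_mono powr_mono') (auto simp: power_le_one)
      also have "\<dots> \<le> B x"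
        unfolding B_def using sum_le_suminf[OF elim, of "{j}"] by simp
      finally have "(((1/2)^j * norm (h j x)) powr r) powr (1 / r) \<le> ?b"
        using r by (intro powr_mono2) auto
      then have "(1/2)^j * norm (h j x) \<le> ?b" using r by (simp add: powr_powr)
      then have "(2/3)^j * ((1/2)^j * norm (h j x)) \<le> (2/3)^j * ?b" by (intro mult_left_mono) auto
      then show ?thesis by (simp add: mult.assoc[symmetric] power_mult_distrib[symmetric])
    qed
    have s23: "summable (\<lambda>j. (2/3)^j * ?b)" by (intro summable_mult2 summable_geometric) auto
    have 1: "summable (\<lambda>j. (1/3)^j * norm (h j x))"
      by (rule summable_comparison_test'[OF s23, of 0]) (use le in auto)
    have "norm (g x) \<le> (\<Sum>j. (2/3)^j * ?b)"
      unfolding g_def by (rule norm_suminf_le[OF _ s23]) (use le s in \<open>auto simp: abs_mult\<close>)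
    also have "\<dots> = 3 * ?b"
      by (subst suminf_mult2[symmetric]) (auto simp: suminf_geometric summable_geometric)
    finally have "norm (g x) powr r \<le> (3 * ?b) powr r" using r by (intro powr_mono2) auto
    also have "\<dots> = 3 powr r * B x"
      using r elim by (simp add: powr_mult powr_powr B_def suminf_nonneg)
    finally show ?case using 1 by simp
  qed
  have int_g: "integrable M (\<lambda>x. norm (g x) powr r)"
    by (rule Bochner_Integration.integrable_bound[OF integrable_mult_right[OF int_B, of "3 powr r"]])
      (use AE_h in \<open>auto elim!: eventually_mono intro: order_trans[OF _ abs_ge_self] simp del: AE_conj_iff\<close>)
  \<comment> \<open>The pairing may be taken termwise: the integrals of the absolute values are
    dominated by \<open>(1/3)^j * N k\<close>.\<close>
  have gV: "(\<integral>x. g x \<bullet> V k x \<partial>M) = (\<Sum>j. (1/3)^j * s j * t k j)" for k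
  proof -
    let ?f = "\<lambda>j x. (1/3)^j * s j * (h j x \<bullet> V k x)"
    have sn: "summable (\<lambda>j. norm (?f j x)) \<and> g x \<bullet> V k x = (\<Sum>j. ?f j x)"
      if x: "summable (\<lambda>j. (1/3)^j * norm (h j x))" for x
    proof
      show "summable (\<lambda>j. norm (?f j x))"
      proof (rule summable_comparison_test'[OF summable_mult2[OF x, of "norm (V k x)"], of 0])
        show "norm (norm (?f j x)) \<le> (1/3)^j * norm (h j x) * norm (V k x)" for j
          using Cauchy_Schwarz_ineq2[of "h j x" "V k x"] s[of j] by (simp add: abs_mult)
      qed
      have "summable (\<lambda>j. ((1/3)^j * s j) *\<^sub>R h j x)"
        by (rule summable_norm_cancel) (use x s in \<open>simp add: abs_mult\<close>)
      from bounded_linear.suminf[OF bounded_linear_inner_left this, of "V k x"]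
      show "g x \<bullet> V k x = (\<Sum>j. ?f j x)" by (simp add: g_def)
    qed
    have "(\<integral>x. g x \<bullet> V k x \<partial>M) = (\<integral>x. (\<Sum>j. ?f j x) \<partial>M)"
      by (rule integral_cong_AE) (use AE_h sn in \<open>auto elim!: eventually_mono simp del: AE_conj_iff\<close>)
    also have "\<dots> = (\<Sum>j. integral\<^sup>L M (?f j))"
    proof (rule integral_suminf)
      show "integrable M (?f j)" for j using int_hV by simp
      show "AE x in M. summable (\<lambda>j. norm (?f j x))"
        using AE_h by eventually_elim (use sn in blast)
      show "summable (\<lambda>j. \<integral>x. norm (?f j x) \<partial>M)"
      proof (rule summable_comparison_test'[of "\<lambda>j. (1/3)^j * N k" 0])
        show "summable (\<lambda>j. (1/3)^j * N k)" by (intro summable_mult2 summable_geometric) auto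
        have "(\<integral>x. \<bar>h j x \<bullet> V k x\<bar> \<partial>M) \<le> N k" for j
          by (rule order_trans[OF integral_mono hV_le[of j k]])
            (use int_hV in \<open>auto simp: Cauchy_Schwarz_ineq2\<close>)
        then show "norm (\<integral>x. norm (?f j x) \<partial>M) \<le> (1/3)^j * N k" for j
          using s[of j] by (simp add: abs_mult)
      qed
    qed
    also have "\<dots> = (\<Sum>j. (1/3)^j * s j * t k j)" by (simp add: t_def)
    finally show ?thesis .
  qed
  from weak[of g] int_g obtain K where K: "\<And>n. \<bar>\<integral>x. g x \<bullet> vs n x \<partial>M\<bar> \<le> K"
    by (auto simp: r_def Bseq_def)
  have "2 ^ k \<le> 2 * K" for k :: nat
  proof -
    have "(2::real)^k = (1/3)^k * 6^k" by (simp flip: power_mult_distrib)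
    also have "\<dots> \<le> (1/3)^k * t k k" using Nk[of k] by (intro mult_left_mono) (auto simp: tkk)
    also have "\<dots> \<le> 2 * \<bar>\<integral>x. g x \<bullet> V k x \<partial>M\<bar>" using hump[of k] by (simp add: gV)
    also have "\<dots> \<le> 2 * K" using K[of "m k"] by (simp add: V_def)
    finally show ?thesis .
  qed
  moreover obtain k :: nat where "2 * K < 2 ^ k" using real_arch_pow[of 2 "2 * K"] by auto
  ultimately show False using not_less by blast
qed

subsection \<open>Integrands and convergence in measure\<close>

text \<open>A simple function has finitely many values, so composing with it only glues finitely
  many measurable sections; continuity in the second variable carries measurability to the pointwise
  limit.\<close>

lemma borel_measurable_caratheodory_compose:
  fixes f :: "'x \<Rightarrow> 'c::euclidean_space \<Rightarrow> real"
  assumes meas: "\<And>z. (\<lambda>x. f x z) \<in> borel_measurable M"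
    and cont: "\<And>x. x \<in> space M \<Longrightarrow> continuous_on UNIV (f x)"
    and u: "u \<in> borel_measurable M"
  shows "(\<lambda>x. f x (u x)) \<in> borel_measurable M"
proof -
  from borel_measurable_implies_sequence_metric[OF u, of 0] obtain F
    where F: "\<And>i. simple_function M (F i)" and lim: "\<And>x. x \<in> space M \<Longrightarrow> (\<lambda>i. F i x) \<longlonglongrightarrow> u x"
    by blast
  have "(\<lambda>x. f x (F i x)) \<in> borel_measurable M" for i
  proof (rule measurable_compose_countable'[where I = "F i ` space M" and f = "\<lambda>z x. f x z"])
    show "F i \<in> measurable M (count_space (F i ` space M))"
      using F[of i] by (subst measurable_count_space_eq2) (auto simp: simple_function_def)
    show "countable (F i ` space M)"
      using F[of i] by (auto simp: simple_function_def intro: countable_finite)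
  qed (rule meas)
  then show ?thesis
  proof (rule borel_measurable_LIMSEQ_real[rotated])
    fix x assume x: "x \<in> space M"
    show "(\<lambda>i. f x (F i x)) \<longlonglongrightarrow> f x (u x)"
      by (rule continuous_on_tendsto_compose[OF cont[OF x] lim[OF x]]) auto
  qed
qed

text \<open>This exchanges "for each \<open>z\<close>, almost everywhere" with "almost everywhere,
  for all \<open>z\<close>". The null sets of a countable dense set can be united. Outside their
  union a violation in \<open>U\<close> would persist on a nonempty open set, which contains a dense
  point.\<close>

lemma AE_ball_open_of_continuous:
  fixes G :: "'x \<Rightarrow> 'c::euclidean_space \<Rightarrow> real"
  assumes "open U" and AE: "\<And>z. z \<in> U \<Longrightarrow> AE x in M. 0 \<le> G x z"
    and cont: "\<And>x. x \<in> space M \<Longrightarrow> continuous_on UNIV (G x)"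
  shows "AE x in M. \<forall>z\<in>U. 0 \<le> G x z"
proof -
  obtain D :: "'c set" where D: "countable D" "\<And>X. open X \<Longrightarrow> X \<noteq> {} \<Longrightarrow> \<exists>d\<in>D. d \<in> X"
    using countable_dense_setE by metis
  have "AE x in M. \<forall>z\<in>D \<inter> U. 0 \<le> G x z"
    using D(1) AE by (subst AE_ball_countable) auto
  with AE_space show ?thesis
  proof eventually_elim
    case (elim x)
    show ?case
    proof (rule ccontr)
      assume "\<not> ?case"
      then have "U \<inter> {z. G x z < 0} \<noteq> {}" by (auto simp: not_le)
      moreover have "open (U \<inter> {z. G x z < 0})"
        using \<open>open U\<close> cont[OF elim(1)] by (intro open_Int open_Collect_less) (auto intro: continuous_intros)
      ultimately obtain d where "d \<in> D" "d \<in> U" "G x d < 0" using D(2) by blast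
      with elim(2) show False by force
    qed
  qed
qed

text \<open>Truncation at a level \<open>k\<close>: the part of \<open>h\<close> above
  \<open>k\<close> has small integral by dominated convergence, and the part below contributes at
  most \<open>k\<close> times the measure of \<open>A\<close>. Finiteness of
  \<open>emeasure M A\<close> is demanded because \<open>measure\<close> is 0 on sets of infinite
  measure.\<close>

lemma integral_absolutely_continuous:
  fixes h :: "'x \<Rightarrow> real"
  assumes int: "integrable M h" and nonneg: "\<And>x. 0 \<le> h x" and "0 < \<epsilon>"
  shows "\<exists>\<delta>>0. \<forall>A\<in>sets M. emeasure M A < \<infinity> \<longrightarrow> measure M A < \<delta> \<longrightarrow> (\<integral>x. indicator A x * h x \<partial>M) < \<epsilon>"
proof -
  have [measurable]: "h \<in> borel_measurable M" using int by blast
  have "(\<lambda>k. \<integral>x. max 0 (h x - real k) \<partial>M) \<longlonglongrightarrow> (\<integral>x. 0 \<partial>M)"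
  proof (rule integral_dominated_convergence[where w = h])
    show "AE x in M. (\<lambda>k. max 0 (h x - real k)) \<longlonglongrightarrow> 0"
    proof (rule AE_I2)
      fix x
      have "\<forall>\<^sub>F k in sequentially. h x \<le> real k"
        using filterlim_real_sequentially by (auto simp: filterlim_at_top)
      then have "\<forall>\<^sub>F k in sequentially. max 0 (h x - real k) = 0" by eventually_elim auto
      then show "(\<lambda>k. max 0 (h x - real k)) \<longlonglongrightarrow> 0" by (rule tendsto_eventually)
    qed
  qed (use nonneg int in auto)
  then have "\<forall>\<^sub>F k in sequentially. (\<integral>x. max 0 (h x - real k) \<partial>M) < \<epsilon> / 2"
    using \<open>0 < \<epsilon>\<close> by (intro order_tendstoD(2)) auto
  then obtain k where k: "(\<integral>x. max 0 (h x - real k) \<partial>M) < \<epsilon> / 2"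
    by (meson eventually_happens' sequentially_bot)
  have int_tail: "integrable M (\<lambda>x. max 0 (h x - real k))"
    by (rule Bochner_Integration.integrable_bound[OF int]) (use nonneg in auto)
  have "(\<integral>x. indicator A x * h x \<partial>M) < \<epsilon>"
    if A[measurable]: "A \<in> sets M" and fin: "emeasure M A < \<infinity>" and small: "measure M A < \<epsilon> / (2 * (real k + 1))" for A
  proof -
    have "(\<integral>x. indicator A x * h x \<partial>M) \<le> (\<integral>x. real k * indicator A x + max 0 (h x - real k) \<partial>M)"
    proof (rule integral_mono)
      show "integrable M (\<lambda>x. indicator A x * h x)"
        using integrable_mult_indicator[OF A int] by simp
      show "integrable M (\<lambda>x. real k * indicator A x + max 0 (h x - real k))"
        using int_tail A fin by (auto intro!: Bochner_Integration.integrable_add integrable_mult_right)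
    qed (auto simp: indicator_def)
    also have "\<dots> = real k * measure M A + (\<integral>x. max 0 (h x - real k) \<partial>M)"
      using int_tail A fin by (subst Bochner_Integration.integral_add) auto
    also have "\<dots> < \<epsilon> / 2 + \<epsilon> / 2"
    proof (rule add_le_less_mono[OF _ k])
      have "real k * measure M A \<le> (real k + 1) * (\<epsilon> / (2 * (real k + 1)))"
        using small by (intro mult_mono) auto
      also have "\<dots> = \<epsilon> / 2" by (simp add: field_simps)
      finally show "real k * measure M A \<le> \<epsilon> / 2" .
    qed
    finally show ?thesis by simp
  qed
  moreover have "0 < \<epsilon> / (2 * (real k + 1))" using \<open>0 < \<epsilon>\<close> by simp
  ultimately show ?thesis by blast
qed

text \<open>Where \<open>us n\<close> is at most \<open>\<delta>\<close>, the pairing costs at most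
  \<open>\<delta>\<close> times the integral of \<open>norm g\<close>. On the remaining set, whose
  measure vanishes, Young's inequality with parameter \<open>\<eta>\<close> separates a fixed
  integrable power of \<open>g\<close>, small there by absolute continuity, from
  \<open>\<eta> powr p\<close> times the bounded integral of
  \<open>norm (us n x) powr p\<close>.\<close>

lemma bounded_Lp_to_zero_in_measure_imp_weakly_to_zero:
  fixes g :: "'x \<Rightarrow> 'a::euclidean_space" and us :: "nat \<Rightarrow> 'x \<Rightarrow> 'a"
  assumes "finite_measure M" and p: "1 < p"
    and [measurable]: "g \<in> borel_measurable M" "\<And>n. us n \<in> borel_measurable M"
    and ig: "integrable M (\<lambda>x. norm (g x) powr (p / (p - 1)))"
    and iu: "\<And>n. integrable M (\<lambda>x. norm (us n x) powr p)"
    and bounded: "\<forall>\<^sub>F n in sequentially. (\<integral>x. norm (us n x) powr p \<partial>M) \<le> K"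
    and conv: "\<And>\<epsilon>. 0 < \<epsilon> \<Longrightarrow> (\<lambda>n. measure M {x\<in>space M. \<epsilon> < norm (us n x)}) \<longlonglongrightarrow> 0"
  shows "(\<lambda>n. \<integral>x. g x \<bullet> us n x \<partial>M) \<longlonglongrightarrow> 0"
proof (rule LIMSEQ_I)
  interpret finite_measure M by fact
  fix \<epsilon> :: real assume \<epsilon>: "0 < \<epsilon>"
  let ?G = "\<lambda>x. norm (g x) powr (p / (p - 1))"
  have "p / (p - 1) > 1" using p by (simp add: field_simps)
  have int_g: "integrable M (\<lambda>x. norm (g x))"
  proof (rule Bochner_Integration.integrable_bound[OF Bochner_Integration.integrable_add[OF integrable_const[of 1] ig]])
    have "y \<le> 1 + y powr (p / (p - 1))" if "0 \<le> y" for y :: real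
    proof (cases "1 \<le> y")
      case True
      then have "y powr 1 \<le> y powr (p / (p - 1))" using \<open>p / (p - 1) > 1\<close> by (intro powr_mono) auto
      with True show ?thesis by simp
    qed (simp add: add_increasing2)
    then show "AE x in M. norm (norm (g x)) \<le> norm (1 + ?G x)" by simp
  qed simp
  \<comment> \<open>The maximum makes the bound positive, and \<open>\<eta>\<close> is then chosen
    so that \<open>\<eta> powr p * K'\<close> equals \<open>\<epsilon> / 3\<close>.\<close>
  define K' where "K' = max 1 K"
  define \<eta> where "\<eta> = (\<epsilon> / (3 * K')) powr (1 / p)"
  have K': "0 < K'" "K \<le> K'" by (auto simp: K'_def)
  have \<eta>: "0 < \<eta>" "\<eta> powr p = \<epsilon> / (3 * K')" using \<epsilon> K' p by (auto simp: \<eta>_def powr_powr)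
  define \<delta> where "\<delta> = \<epsilon> / (4 * ((\<integral>x. norm (g x) \<partial>M) + 1))"
  have G0: "0 \<le> (\<integral>x. norm (g x) \<partial>M)" by simp
  then have \<delta>: "0 < \<delta>" unfolding \<delta>_def using \<epsilon> by (intro divide_pos_pos mult_pos_pos add_nonneg_pos) auto
  have "integrable M (\<lambda>x. (norm (g x) / \<eta>) powr (p / (p - 1)))"
    using ig \<eta> by (simp add: powr_divide)
  from integral_absolutely_continuous[OF this, of "\<epsilon> / 3"] \<epsilon> obtain d where d: "0 < d"
    "\<And>A. A \<in> sets M \<Longrightarrow> measure M A < d \<Longrightarrow> (\<integral>x. indicator A x * (norm (g x) / \<eta>) powr (p / (p - 1)) \<partial>M) < \<epsilon> / 3"
    by (auto simp: less_top[symmetric])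
  have "\<forall>\<^sub>F n in sequentially. measure M {x\<in>space M. \<delta> < norm (us n x)} < d"
    using conv[OF \<delta>] d(1) by (intro order_tendstoD(2))
  with bounded have "\<forall>\<^sub>F n in sequentially. norm ((\<integral>x. g x \<bullet> us n x \<partial>M) - 0) < \<epsilon>"
  proof eventually_elim
    case (elim n)
    let ?A = "{x\<in>space M. \<delta> < norm (us n x)}"
    have A[measurable]: "?A \<in> sets M" by measurable
    have int_A: "integrable M (\<lambda>x. indicator ?A x * (norm (g x) / \<eta>) powr (p / (p - 1)))"
      using integrable_mult_indicator[OF A ig] \<eta> by (simp add: powr_divide)
    have "\<bar>\<integral>x. g x \<bullet> us n x \<partial>M\<bar> \<le> (\<integral>x. \<bar>g x \<bullet> us n x\<bar> \<partial>M)" by (rule integral_abs_bound)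
    also have "\<dots> \<le> (\<integral>x. \<delta> * norm (g x) + (indicator ?A x * (norm (g x) / \<eta>) powr (p / (p - 1))
        + \<eta> powr p * norm (us n x) powr p) \<partial>M)"
    proof (rule integral_mono)
      show "integrable M (\<lambda>x. \<bar>g x \<bullet> us n x\<bar>)"
        using integrable_inner_conjugate(2)[OF p, of g M "us n"] ig iu by simp
      show "integrable M (\<lambda>x. \<delta> * norm (g x) + (indicator ?A x * (norm (g x) / \<eta>) powr (p / (p - 1))
        + \<eta> powr p * norm (us n x) powr p))"
        using int_g int_A iu by (intro Bochner_Integration.integrable_add integrable_mult_right) auto
      fix x assume x: "x \<in> space M"
      have "\<bar>g x \<bullet> us n x\<bar> \<le> norm (g x) * norm (us n x)" by (rule Cauchy_Schwarz_ineq2)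
      also have "\<dots> \<le> \<delta> * norm (g x) + (indicator ?A x * (norm (g x) / \<eta>) powr (p / (p - 1))
        + \<eta> powr p * norm (us n x) powr p)"
      proof (cases "x \<in> ?A")
        case True
        then show ?thesis
          using Youngs_inequality_scaled[OF p \<eta>(1), of "norm (g x)" "norm (us n x)"] \<eta>(1) \<delta>
          by (simp add: powr_mult add_increasing)
      next
        case False
        then have "norm (g x) * norm (us n x) \<le> norm (g x) * \<delta>" using x by (intro mult_left_mono) auto
        with False show ?thesis by (simp add: mult.commute add_increasing2)
      qed
      finally show "\<bar>g x \<bullet> us n x\<bar> \<le> \<delta> * norm (g x) + (indicator ?A x * (norm (g x) / \<eta>) powr (p / (p - 1))
        + \<eta> powr p * norm (us n x) powr p)" .
    qed
    also have "\<dots> = \<delta> * (\<integral>x. norm (g x) \<partial>M) + ((\<integral>x. indicator ?A x * (norm (g x) / \<eta>) powr (p / (p - 1)) \<partial>M)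
        + \<eta> powr p * (\<integral>x. norm (us n x) powr p \<partial>M))"
      using int_g int_A iu by (subst Bochner_Integration.integral_add; (subst Bochner_Integration.integral_add)?) auto
    also have "\<dots> < \<epsilon>"
    proof -
      have "\<delta> * (\<integral>x. norm (g x) \<partial>M) < \<epsilon> / 3"
        using \<epsilon> G0 unfolding \<delta>_def by (simp add: field_simps add_pos_nonneg)
      moreover have "(\<integral>x. indicator ?A x * (norm (g x) / \<eta>) powr (p / (p - 1)) \<partial>M) < \<epsilon> / 3"
        using d(2)[OF A] elim by blast
      moreover have "\<eta> powr p * (\<integral>x. norm (us n x) powr p \<partial>M) \<le> \<epsilon> / (3 * K') * K'"
        unfolding \<eta>(2) using elim K' \<epsilon> by (intro mult_left_mono) auto
      moreover have "\<epsilon> / (3 * K') * K' = \<epsilon> / 3" using K' by simp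
      ultimately show ?thesis by linarith
    qed
    finally show ?case by simp
  qed
  then show "\<exists>no. \<forall>n\<ge>no. norm ((\<integral>x. g x \<bullet> us n x \<partial>M) - 0) < \<epsilon>"
    by (simp add: eventually_sequentially)
qed

subsection \<open>Equi-integrable modifications\<close>

text \<open>The expression common to the growth bound in (H2) and to equi-integrability. Working
  with it in place of norms avoids roots with two different exponents.\<close>

definition modular :: "real \<Rightarrow> real \<Rightarrow> 'a::euclidean_space \<times> 'b::euclidean_space \<Rightarrow> real" where
  "modular p q z = norm (fst z) powr p + norm (snd z) powr q"

lemma modular_nonneg [simp]: "0 \<le> modular p q z"
  by (simp add: modular_def)

lemma borel_measurable_modular [measurable]: "modular p q \<in> borel_measurable borel"
  unfolding modular_def borel_prod[symmetric] by measurable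

text \<open>One component has norm at least \<open>R / 2\<close>, which is at least 1, and powers
  with exponent at least 1 do not decrease such numbers. Through Markov's inequality this bounds the
  measure of the set where a function is large.\<close>

lemma modular_ge_half_norm:
  assumes "1 \<le> p" "1 \<le> q" "2 \<le> R" "R < norm z"
  shows "R / 2 \<le> modular p q z"
proof -
  have *: "R / 2 \<le> y powr s" if "R / 2 \<le> y" "1 \<le> s" for y s :: real
  proof -
    have "y powr 1 \<le> y powr s" using that assms by (intro powr_mono) auto
    with that assms show ?thesis by simp
  qed
  have "norm z \<le> norm (fst z) + norm (snd z)"
    by (metis norm_Pair_le prod.collapse)
  with assms have "R / 2 \<le> norm (fst z) \<or> R / 2 \<le> norm (snd z)" by linarith
  then show ?thesis
    using *[of "norm (fst z)" p] *[of "norm (snd z)" q] assms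
    by (auto simp: modular_def intro: add_increasing add_increasing2)
qed

lemma norm_diff_powr_le:
  fixes a b :: "'a::real_normed_vector"
  assumes "0 < p"
  shows "norm (a - b) powr p \<le> 2 powr p * (norm a powr p + norm b powr p)"
proof -
  let ?m = "max (norm a) (norm b)"
  have "norm (a - b) \<le> 2 * ?m" using norm_triangle_ineq4[of a b] by linarith
  then have "norm (a - b) powr p \<le> (2 * ?m) powr p" using assms by (intro powr_mono2) auto
  also have "\<dots> = 2 powr p * ?m powr p" by (simp add: powr_mult)
  also have "?m powr p \<le> norm a powr p + norm b powr p" by (simp add: max_def)
  finally show ?thesis by simp
qed

lemma modular_diff_le:
  assumes "0 < p" "0 < q"
  shows "modular p q (z - z') \<le> (2 powr p + 2 powr q) * (modular p q z + modular p q z')"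
proof -
  have "modular p q (z - z') \<le> 2 powr p * (norm (fst z) powr p + norm (fst z') powr p)
      + 2 powr q * (norm (snd z) powr q + norm (snd z') powr q)"
    using assms by (auto simp: modular_def intro!: add_mono norm_diff_powr_le)
  also have "\<dots> \<le> 2 powr p * (modular p q z + modular p q z') + 2 powr q * (modular p q z + modular p q z')"
    by (intro add_mono mult_left_mono) (auto simp: modular_def)
  finally show ?thesis by (simp add: algebra_simps)
qed

lemma modular_le_2:
  assumes "norm z \<le> 1" "0 < p" "0 < q"
  shows "modular p q z \<le> 2"
proof -
  have "norm (fst z) \<le> 1" "norm (snd z) \<le> 1"
    using assms(1) norm_fst_le[of "fst z" "snd z"] norm_snd_le[of "snd z" "fst z"] by auto
  then have "norm (fst z) powr p \<le> 1 powr p" "norm (snd z) powr q \<le> 1 powr q"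
    using assms by (intro powr_mono2; simp)+
  then show ?thesis by (simp add: modular_def)
qed

text \<open>The situation produced by (H1), with all integrals taken over one finite measure space.
  An integral bound is assumed for \<open>vs\<close> only, and control on small sets for
  \<open>ws\<close> only.\<close>

locale equi_integrable_modification = finite_measure M
  for M :: "'x measure" and p q :: real
    and vs ws :: "nat \<Rightarrow> 'x \<Rightarrow> 'a::euclidean_space \<times> 'b::euclidean_space" and K :: real +
  assumes p: "1 < p" and q: "1 < q"
    and vs_meas [measurable]: "\<And>n. vs n \<in> borel_measurable M"
    and ws_meas [measurable]: "\<And>n. ws n \<in> borel_measurable M"
    and vs_int: "\<And>n. integrable M (\<lambda>x. modular p q (vs n x))"
    and ws_int: "\<And>n. integrable M (\<lambda>x. modular p q (ws n x))"
    and vs_bounded: "\<And>n. (\<integral>x. modular p q (vs n x) \<partial>M) \<le> K"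
    and equi: "\<And>\<epsilon>. 0 < \<epsilon> \<Longrightarrow> \<exists>\<delta>>0. \<forall>A\<in>sets M. measure M A < \<delta> \<longrightarrow>
      (\<forall>n. (\<integral>x. indicator A x * modular p q (ws n x) \<partial>M) < \<epsilon>)"
    and conv: "\<And>\<epsilon>. 0 < \<epsilon> \<Longrightarrow> (\<lambda>n. measure M {x\<in>space M. \<epsilon> < norm (ws n x - vs n x)}) \<longlonglongrightarrow> 0"
begin

text \<open>Equi-integrability alone does not bound the total mass of \<open>ws\<close>, as
  \<open>M\<close> may have atoms. Where \<open>ws n\<close> is within 1 of \<open>vs n\<close> the
  modular of the difference is at most 2; the remaining set is eventually small enough for
  equi-integrability with bound 1. Hence the bound holds only from some index on.\<close>

lemma diff_modular_bounded:
  "integrable M (\<lambda>x. modular p q (ws n x - vs n x))"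
  "\<exists>K'. \<forall>\<^sub>F n in sequentially. (\<integral>x. modular p q (ws n x - vs n x) \<partial>M) \<le> K'"
proof -
  define c where "c = 2 powr p + 2 powr q"
  have c: "0 \<le> c" by (simp add: c_def)
  have diff: "modular p q (ws n x - vs n x) \<le> c * (modular p q (ws n x) + modular p q (vs n x))" for n x
    using modular_diff_le[of p q "ws n x" "vs n x"] p q by (simp add: c_def)
  show int: "integrable M (\<lambda>x. modular p q (ws n x - vs n x))" for n
    by (rule Bochner_Integration.integrable_bound[where f = "\<lambda>x. c * (modular p q (ws n x) + modular p q (vs n x))"])
      (use ws_int vs_int diff c in \<open>auto simp: abs_mult\<close>)
  obtain \<delta> where \<delta>: "0 < \<delta>" "\<And>A n. A \<in> sets M \<Longrightarrow> measure M A < \<delta> \<Longrightarrow>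
      (\<integral>x. indicator A x * modular p q (ws n x) \<partial>M) < 1"
    using equi[of 1] by auto
  have "\<forall>\<^sub>F n in sequentially. measure M {x\<in>space M. 1 < norm (ws n x - vs n x)} < \<delta>"
    using conv[of 1] \<delta>(1) by (intro order_tendstoD(2)) auto
  then have "\<forall>\<^sub>F n in sequentially. (\<integral>x. modular p q (ws n x - vs n x) \<partial>M) \<le> 2 * measure M (space M) + c * (1 + K)"
  proof eventually_elim
    case (elim n)
    let ?A = "{x\<in>space M. 1 < norm (ws n x - vs n x)}"
    have A: "?A \<in> sets M" by measurable
    have int_A: "integrable M (\<lambda>x. indicator ?A x * modular p q (ws n x))"
      using integrable_mult_indicator[OF A ws_int] by simp
    have "(\<integral>x. modular p q (ws n x - vs n x) \<partial>M)
        \<le> (\<integral>x. 2 + c * (indicator ?A x * modular p q (ws n x) + modular p q (vs n x)) \<partial>M)"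
    proof (rule integral_mono[OF int])
      show "integrable M (\<lambda>x. 2 + c * (indicator ?A x * modular p q (ws n x) + modular p q (vs n x)))"
        using int_A vs_int by simp
      fix x assume x: "x \<in> space M"
      show "modular p q (ws n x - vs n x) \<le> 2 + c * (indicator ?A x * modular p q (ws n x) + modular p q (vs n x))"
      proof (cases "x \<in> ?A")
        case True
        then show ?thesis using diff[of n x] by simp
      next
        case False
        then show ?thesis using modular_le_2[of "ws n x - vs n x" p q] x p q c by (simp add: add_increasing2)
      qed
    qed
    also have "\<dots> = 2 * measure M (space M)
        + c * ((\<integral>x. indicator ?A x * modular p q (ws n x) \<partial>M) + (\<integral>x. modular p q (vs n x) \<partial>M))"
      using int_A vs_int by simp
    also have "\<dots> \<le> 2 * measure M (space M) + c * (1 + K)"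
      using \<delta>(2)[OF A elim, of n] vs_bounded[of n] c by (intro add_mono mult_left_mono) auto
    finally show ?case .
  qed
  then show "\<exists>K'. \<forall>\<^sub>F n in sequentially. (\<integral>x. modular p q (ws n x - vs n x) \<partial>M) \<le> K'" ..
qed

text \<open>Outside the small set where \<open>vs n\<close> is large or far from \<open>ws n\<close> the integrands differ little by
  equicontinuity; on that set the integrand at \<open>vs n\<close> is dropped because it is nonnegative, and the
  integrand at \<open>ws n\<close> is controlled by equi-integrability. This is why the estimate is one-sided.\<close>
lemma eventually_integral_le:
  fixes g :: "nat \<Rightarrow> 'x \<Rightarrow> 'a \<times> 'b \<Rightarrow> real"
  assumes meas: "\<And>n u. u \<in> borel_measurable M \<Longrightarrow> (\<lambda>x. g n x (u x)) \<in> borel_measurable M"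
    and "0 < C"
    and growth: "\<And>n. AE x in M. \<forall>z. 0 \<le> g n x z \<and> g n x z \<le> C * (1 + modular p q z)"
    and modulus: "\<And>R \<omega>. 0 < R \<Longrightarrow> 0 < \<omega> \<Longrightarrow> \<exists>\<delta>>0. \<forall>n. AE x in M. \<forall>z z'.
      norm z < R \<longrightarrow> norm z' < R \<longrightarrow> norm (z - z') < \<delta> \<longrightarrow> \<bar>g n x z - g n x z'\<bar> \<le> \<omega>"
    and "0 < \<epsilon>"
  shows "\<forall>\<^sub>F n in sequentially. (\<integral>x. g n x (ws n x) \<partial>M) \<le> (\<integral>x. g n x (vs n x) \<partial>M) + \<epsilon>"
proof -
  have int_g: "integrable M (\<lambda>x. g n x (u x))"
    if "u \<in> borel_measurable M" "integrable M (\<lambda>x. modular p q (u x))" for n u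
    by (rule Bochner_Integration.integrable_bound[where f = "\<lambda>x. C * (1 + modular p q (u x))"])
      (use that meas growth[of n] in \<open>auto elim!: eventually_mono intro: order_trans[OF _ abs_ge_self]
        simp del: AE_conj_iff AE_all_countable split_paired_All\<close>)
  define \<mu> where "\<mu> = measure M (space M)"
  define \<omega> where "\<omega> = \<epsilon> / (3 * (\<mu> + 1))"
  have \<mu>: "0 \<le> \<mu>" by (simp add: \<mu>_def)
  then have \<omega>: "0 < \<omega>" "\<omega> * \<mu> \<le> \<epsilon> / 3" using \<open>0 < \<epsilon>\<close> by (auto simp: \<omega>_def field_simps)
  obtain \<delta>\<^sub>1 where \<delta>\<^sub>1: "0 < \<delta>\<^sub>1" "\<And>A n. A \<in> sets M \<Longrightarrow> measure M A < \<delta>\<^sub>1 \<Longrightarrow>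
      (\<integral>x. indicator A x * modular p q (ws n x) \<partial>M) < \<epsilon> / (3 * C)"
    using equi[of "\<epsilon> / (3 * C)"] \<open>0 < \<epsilon>\<close> \<open>0 < C\<close> by auto
  \<comment> \<open>On the exceptional set the growth bound has two parts, \<open>C\<close> times
    the measure and \<open>C\<close> times the modular of \<open>ws n\<close>. The two entries of
    the minimum limit each part to \<open>\<epsilon> / 3\<close>.\<close>
  define \<eta> where "\<eta> = min \<delta>\<^sub>1 (\<epsilon> / (3 * C))"
  have \<eta>: "0 < \<eta>" using \<delta>\<^sub>1 \<open>0 < \<epsilon>\<close> \<open>0 < C\<close> by (simp add: \<eta>_def)
  \<comment> \<open>The entry 2 admits \<open>modular_ge_half_norm\<close>. The other entry makes
    the Markov bound \<open>K / (R / 2)\<close> strictly smaller than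
    \<open>\<eta> / 2\<close>.\<close>
  define R where "R = max 2 (8 * (\<bar>K\<bar> + 1) / \<eta>)"
  have R: "2 \<le> R" "8 * (\<bar>K\<bar> + 1) / \<eta> \<le> R" by (auto simp: R_def)
  have large: "measure M {x\<in>space M. R < norm (vs n x)} < \<eta> / 2" for n
  proof -
    have "measure M {x\<in>space M. R < norm (vs n x)} \<le> measure M {x\<in>space M. R / 2 \<le> modular p q (vs n x)}"
      using modular_ge_half_norm[of p q R "vs n x" for x] p q R by (intro finite_measure_mono) auto
    also have "\<dots> \<le> (\<integral>x. modular p q (vs n x) \<partial>M) / (R / 2)"
      using R by (intro integral_Markov_inequality_measure[where A = "{}"] vs_int) auto
    also have "\<dots> \<le> K / (R / 2)" using vs_bounded[of n] R by (intro divide_right_mono) auto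
    also have "\<dots> < \<eta> / 2"
    proof -
      have "8 * (\<bar>K\<bar> + 1) \<le> R * \<eta>" using R(2) \<eta> by (simp add: field_simps)
      moreover have "4 * K < 8 * (\<bar>K\<bar> + 1)" using abs_ge_self[of K] abs_ge_zero[of K] by argo
      ultimately have "4 * K < R * \<eta>" by (rule less_le_trans[rotated])
      then show ?thesis using R by (simp add: field_simps)
    qed
    finally show ?thesis .
  qed
  \<comment> \<open>The radius is \<open>R + 1\<close> since \<open>ws n\<close> will be within
    distance less than 1 of a value of norm at most \<open>R\<close>.\<close>
  obtain \<delta>\<^sub>2 where \<delta>\<^sub>2: "0 < \<delta>\<^sub>2" "\<And>n. AE x in M. \<forall>z z'. norm z < R + 1 \<longrightarrow> norm z' < R + 1 \<longrightarrow>
      norm (z - z') < \<delta>\<^sub>2 \<longrightarrow> \<bar>g n x z - g n x z'\<bar> \<le> \<omega>"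
    using modulus[of "R + 1" \<omega>] R \<omega> by auto
  \<comment> \<open>Halving gives strict inequalities: off the exceptional set the distance is only
    known to be at most \<open>\<delta>\<close>, whereas the modulus asks for strictly less than
    \<open>\<delta>\<^sub>2\<close>.\<close>
  define \<delta> where "\<delta> = min \<delta>\<^sub>2 1 / 2"
  have \<delta>: "0 < \<delta>" "\<delta> < \<delta>\<^sub>2" "\<delta> < 1" using \<delta>\<^sub>2(1) by (auto simp: \<delta>_def)
  have "\<forall>\<^sub>F n in sequentially. measure M {x\<in>space M. \<delta> < norm (ws n x - vs n x)} < \<eta> / 2"
    using conv[OF \<delta>(1)] \<eta> by (intro order_tendstoD(2)) auto
  then show ?thesis
  proof eventually_elim
    case (elim n)
    let ?E = "{x\<in>space M. R < norm (vs n x)} \<union> {x\<in>space M. \<delta> < norm (ws n x - vs n x)}"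
    have E: "?E \<in> sets M" by measurable
    have "measure M ?E \<le> measure M {x\<in>space M. R < norm (vs n x)} + measure M {x\<in>space M. \<delta> < norm (ws n x - vs n x)}"
      by (intro measure_Un_le) auto
    with large[of n] elim have small: "measure M ?E < \<eta>" by linarith
    have int_E: "integrable M (\<lambda>x. indicator ?E x * modular p q (ws n x))"
      using integrable_mult_indicator[OF E ws_int] by simp
    have "(\<integral>x. g n x (ws n x) \<partial>M)
        \<le> (\<integral>x. g n x (vs n x) + (\<omega> + C * (indicator ?E x + indicator ?E x * modular p q (ws n x))) \<partial>M)"
    proof (rule integral_mono_AE)
      show "integrable M (\<lambda>x. g n x (ws n x))" by (intro int_g ws_meas ws_int)
      show "integrable M (\<lambda>x. g n x (vs n x) + (\<omega> + C * (indicator ?E x + indicator ?E x * modular p q (ws n x))))"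
        using int_E E by (intro Bochner_Integration.integrable_add integrable_mult_right int_g vs_meas vs_int
            integrable_real_indicator) (auto simp: less_top[symmetric])
      show "AE x in M. g n x (ws n x)
          \<le> g n x (vs n x) + (\<omega> + C * (indicator ?E x + indicator ?E x * modular p q (ws n x)))"
        using AE_space growth[of n] \<delta>\<^sub>2(2)[of n]
      proof eventually_elim
        case (elim x)
        show ?case
        proof (cases "x \<in> ?E")
          case True
          have "g n x (ws n x) \<le> C * (1 + modular p q (ws n x))" "0 \<le> g n x (vs n x)" using elim(2) by blast+
          then show ?thesis using True \<omega>(1) by simp
        next
          case False
          then have "norm (vs n x) < R + 1" "norm (ws n x - vs n x) < \<delta>\<^sub>2" "norm (ws n x) < R + 1"
            using elim(1) \<delta> norm_triangle_ineq2[of "ws n x" "vs n x"] by auto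
          then have "\<bar>g n x (ws n x) - g n x (vs n x)\<bar> \<le> \<omega>" using elim(3) by blast
          then show ?thesis using False by simp
        qed
      qed
    qed
    also have "\<dots> = (\<integral>x. g n x (vs n x) \<partial>M)
        + (\<omega> * \<mu> + C * (measure M ?E + (\<integral>x. indicator ?E x * modular p q (ws n x) \<partial>M)))"
    proof -
      have iE: "integrable M (indicator ?E :: 'x \<Rightarrow> real)" using E by (auto simp: less_top[symmetric])
      have eq: "(\<integral>x. indicator ?E x \<partial>M) = measure M ?E"
        using sets.Int_space_eq2[OF E] by simp
      show ?thesis
        unfolding eq[symmetric] \<mu>_def using int_E iE int_g[OF vs_meas vs_int, of n n]
        by (simp add: mult.commute del: integral_indicator Bochner_Integration.integral_indicator)
    qed
    also have "\<dots> \<le> (\<integral>x. g n x (vs n x) \<partial>M) + (\<epsilon> / 3 + C * (\<epsilon> / (3 * C) + \<epsilon> / (3 * C)))"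
      using \<omega>(2) small \<delta>\<^sub>1(2)[OF E, of n] \<open>0 < C\<close> by (intro add_mono mult_left_mono) (auto simp: \<eta>_def)
    also have "\<dots> = (\<integral>x. g n x (vs n x) \<partial>M) + \<epsilon>" using \<open>0 < C\<close> by (simp add: field_simps)
    finally show ?case .
  qed
qed

end

subsection \<open>Weak convergence in the product space\<close>

lemma borel_measurable_fst_snd:
  fixes v :: "'x \<Rightarrow> 'a::euclidean_space \<times> 'b::euclidean_space"
  assumes "v \<in> borel_measurable M"
  shows "(\<lambda>x. fst (v x)) \<in> borel_measurable M" "(\<lambda>x. snd (v x)) \<in> borel_measurable M"
  by (rule measurable_compose[OF assms], simp add: borel_measurable_continuous_onI continuous_intros)+

lemma Lpq_space_iff:
  fixes v :: "'d::euclidean_space \<Rightarrow> 'a::euclidean_space \<times> 'b::euclidean_space"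
  shows "v \<in> Lpq_space \<Omega> p q \<longleftrightarrow>
    v \<in> borel_measurable (lebesgue_on \<Omega>) \<and> integrable (lebesgue_on \<Omega>) (\<lambda>x. modular p q (v x))"
proof (intro iffI conjI)
  assume v: "v \<in> Lpq_space \<Omega> p q"
  then have "(\<lambda>x. (fst (v x), snd (v x))) \<in> borel_measurable (lebesgue_on \<Omega>)"
    by (intro borel_measurable_Pair) (auto simp: Lpq_space_def Lp_space_def)
  then show "v \<in> borel_measurable (lebesgue_on \<Omega>)" by simp
  show "integrable (lebesgue_on \<Omega>) (\<lambda>x. modular p q (v x))"
    unfolding modular_def using v by (intro Bochner_Integration.integrable_add) (auto simp: Lpq_space_def Lp_space_def)
next
  assume v: "v \<in> borel_measurable (lebesgue_on \<Omega>) \<and> integrable (lebesgue_on \<Omega>) (\<lambda>x. modular p q (v x))"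
  then have [measurable]: "(\<lambda>x. fst (v x)) \<in> borel_measurable (lebesgue_on \<Omega>)"
    "(\<lambda>x. snd (v x)) \<in> borel_measurable (lebesgue_on \<Omega>)"
    by (auto intro: borel_measurable_fst_snd)
  have "integrable (lebesgue_on \<Omega>) (\<lambda>x. norm (fst (v x)) powr p)"
    "integrable (lebesgue_on \<Omega>) (\<lambda>x. norm (snd (v x)) powr q)"
    by (rule Bochner_Integration.integrable_bound[where f = "\<lambda>x. modular p q (v x)"]; use v in \<open>simp add: modular_def\<close>)+
  then show "v \<in> Lpq_space \<Omega> p q" by (simp add: Lpq_space_def Lp_space_def)
qed

text \<open>Convergence can be tested on a subbase, because sets that eventually contain the
  sequence are closed under finite intersections and supersets. Membership in the union of
  \<open>S\<close> says that the limit is a point of the generated space.\<close>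

lemma limitin_topology_generated_by:
  "limitin (topology_generated_by S) f l F \<longleftrightarrow> l \<in> \<Union>S \<and> (\<forall>U\<in>S. l \<in> U \<longrightarrow> (\<forall>\<^sub>F x in F. f x \<in> U))"
proof
  assume "limitin (topology_generated_by S) f l F"
  then show "l \<in> \<Union>S \<and> (\<forall>U\<in>S. l \<in> U \<longrightarrow> (\<forall>\<^sub>F x in F. f x \<in> U))"
    by (auto simp: limitin_def topology_generated_by_Basis)
next
  assume *: "l \<in> \<Union>S \<and> (\<forall>U\<in>S. l \<in> U \<longrightarrow> (\<forall>\<^sub>F x in F. f x \<in> U))"
  have "l \<in> U \<longrightarrow> (\<forall>\<^sub>F x in F. f x \<in> U)" if "generate_topology_on S U" for U
    using that
  proof induction
    case (UN K)
    then show ?case by (blast intro: eventually_mono)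
  qed (use * in \<open>auto intro: eventually_conj\<close>)
  with * show "limitin (topology_generated_by S) f l F"
    by (auto simp: limitin_def openin_topology_generated_by_iff)
qed

lemma zero_in_Lp_space [simp]: "(\<lambda>x. 0) \<in> Lp_space \<Omega> p"
  by (simp add: Lp_space_def)

text \<open>Each subbasic set tests one pair \<open>g1\<close>, \<open>g2\<close> against one open
  set \<open>U\<close>; for a fixed pair, letting \<open>U\<close> vary is convergence of the real
  pairings.\<close>

lemma weak_conv_iff:
  "weak_conv \<Omega> p q vs v \<longleftrightarrow> (\<forall>n. vs n \<in> Lpq_space \<Omega> p q) \<and> v \<in> Lpq_space \<Omega> p q \<and>
    (\<forall>g1\<in>Lp_space \<Omega> (p / (p - 1)). \<forall>g2\<in>Lp_space \<Omega> (q / (q - 1)).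
      (\<lambda>n. \<integral>x. g1 x \<bullet> fst (vs n x) + g2 x \<bullet> snd (vs n x) \<partial>(lebesgue_on \<Omega>))
        \<longlonglongrightarrow> (\<integral>x. g1 x \<bullet> fst (v x) + g2 x \<bullet> snd (v x) \<partial>(lebesgue_on \<Omega>)))"
  (is "?L \<longleftrightarrow> ?V \<and> ?v \<and> (\<forall>g1\<in>?P. \<forall>g2\<in>?Q. (\<lambda>n. ?I g1 g2 (vs n)) \<longlonglongrightarrow> ?I g1 g2 v)")
proof -
  define W where "W g1 g2 U = {v \<in> Lpq_space \<Omega> p q. ?I g1 g2 v \<in> U}" for g1 g2 U
  let ?S = "{W g1 g2 U | g1 g2 U. g1 \<in> ?P \<and> g2 \<in> ?Q \<and> open U}"
  \<comment> \<open>The zero pairing with \<open>U = UNIV\<close> shows that the underlying space of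
    the topology is all of \<open>Lpq_space\<close>.\<close>
  have "W (\<lambda>x. 0) (\<lambda>x. 0) UNIV \<in> ?S"
    by (rule CollectI, rule exI[of _ "\<lambda>x. 0"], rule exI[of _ "\<lambda>x. 0"], rule exI[of _ UNIV]) simp
  moreover have "W (\<lambda>x. 0) (\<lambda>x. 0) UNIV = Lpq_space \<Omega> p q" "W g1 g2 U \<subseteq> Lpq_space \<Omega> p q" for g1 g2 U
    by (auto simp: W_def)
  ultimately have "\<Union>?S = Lpq_space \<Omega> p q" by blast
  then have "?L \<longleftrightarrow> ?V \<and> ?v \<and> (\<forall>A\<in>?S. v \<in> A \<longrightarrow> (\<forall>\<^sub>F n in sequentially. vs n \<in> A))"
    unfolding weak_conv_def weak_top_def limitin_topology_generated_by W_def by (simp only:)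
  also have "\<dots> \<longleftrightarrow> ?V \<and> ?v \<and> (\<forall>g1\<in>?P. \<forall>g2\<in>?Q. \<forall>U. open U \<longrightarrow> v \<in> W g1 g2 U \<longrightarrow>
      (\<forall>\<^sub>F n in sequentially. vs n \<in> W g1 g2 U))"
    by blast
  also have "\<dots> \<longleftrightarrow> ?V \<and> ?v \<and> (\<forall>g1\<in>?P. \<forall>g2\<in>?Q. (\<lambda>n. ?I g1 g2 (vs n)) \<longlonglongrightarrow> ?I g1 g2 v)"
    unfolding tendsto_def W_def by (simp cong: conj_cong)
  finally show ?thesis .
qed

lemma weak_conv_subseq:
  assumes "weak_conv \<Omega> p q vs v" "strict_mono r"
  shows "weak_conv \<Omega> p q (\<lambda>n. vs (r n)) v"
  using assms LIMSEQ_subseq_LIMSEQ[OF _ assms(2)] unfolding weak_conv_iff by (fastforce simp: o_def)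

lemma weak_conv_imp_bounded_seq:
  fixes vs :: "nat \<Rightarrow> 'd::euclidean_space \<Rightarrow> 'a::euclidean_space \<times> 'b::euclidean_space"
  assumes "weak_conv \<Omega> p q vs v" "1 < p" "1 < q"
  shows "bounded_seq \<Omega> p q vs"
proof -
  let ?M = "lebesgue_on \<Omega>"
  have vs: "vs n \<in> Lpq_space \<Omega> p q" for n using assms(1) by (simp add: weak_conv_iff)
  have conv: "convergent (\<lambda>n. \<integral>x. g1 x \<bullet> fst (vs n x) + g2 x \<bullet> snd (vs n x) \<partial>?M)"
    if "g1 \<in> Lp_space \<Omega> (p / (p - 1))" "g2 \<in> Lp_space \<Omega> (q / (q - 1))" for g1 g2
    using assms(1) that unfolding weak_conv_iff convergent_def by blast
  have "\<exists>K. \<forall>n. (\<integral>x. norm (fst (vs n x)) powr p \<partial>?M) \<le> K"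
  proof (rule weakly_bounded_imp_bounded_Lp)
    \<comment> \<open>A test pair with one zero component isolates a single factor of the product
      space.\<close>
    show "Bseq (\<lambda>n. \<integral>x. g x \<bullet> fst (vs n x) \<partial>?M)"
      if "g \<in> borel_measurable ?M" "integrable ?M (\<lambda>x. norm (g x) powr (p / (p - 1)))" for g
      using convergent_imp_Bseq[OF conv[of g "\<lambda>x. 0"]] that by (simp add: Lp_space_def)
  qed (use vs assms in \<open>auto simp: Lpq_space_def Lp_space_def\<close>)
  moreover have "\<exists>K. \<forall>n. (\<integral>x. norm (snd (vs n x)) powr q \<partial>?M) \<le> K"
  proof (rule weakly_bounded_imp_bounded_Lp)
    show "Bseq (\<lambda>n. \<integral>x. g x \<bullet> snd (vs n x) \<partial>?M)"
      if "g \<in> borel_measurable ?M" "integrable ?M (\<lambda>x. norm (g x) powr (q / (q - 1)))" for g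
      using convergent_imp_Bseq[OF conv[of "\<lambda>x. 0" g]] that by (simp add: Lp_space_def)
  qed (use vs assms in \<open>auto simp: Lpq_space_def Lp_space_def\<close>)
  ultimately obtain K K' where "\<And>n. (\<integral>x. norm (fst (vs n x)) powr p \<partial>?M) \<le> K"
    "\<And>n. (\<integral>x. norm (snd (vs n x)) powr q \<partial>?M) \<le> K'" by blast
  then have "\<forall>n. (\<integral>x. norm (fst (vs n x)) powr p \<partial>?M) \<le> max K K' \<and>
      (\<integral>x. norm (snd (vs n x)) powr q \<partial>?M) \<le> max K K'"
    by (meson max.coboundedI1 max.coboundedI2)
  with vs show ?thesis unfolding bounded_seq_def by blast
qed

text \<open>The definitions use a separate measure \<open>lebesgue_on E\<close> for each
  \<open>E\<close> and extended-real measures. Here they are rewritten with indicators and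
  real-valued measures over the single space \<open>lebesgue_on \<Omega>\<close>.\<close>

lemma equi_integrable_modificationI:
  fixes vs ws :: "nat \<Rightarrow> 'd::euclidean_space \<Rightarrow> 'a::euclidean_space \<times> 'b::euclidean_space"
  assumes \<Omega>: "\<Omega> \<in> lmeasurable" and "1 < p" "1 < q"
    and vs: "bounded_seq \<Omega> p q vs"
    and ws: "equi_integrable \<Omega> p q (range ws)"
    and conv: "to_zero_in_measure \<Omega> (\<lambda>n x. ws n x - vs n x)"
  shows "\<exists>K. equi_integrable_modification (lebesgue_on \<Omega>) p q vs ws K"
proof -
  let ?M = "lebesgue_on \<Omega>"
  interpret finite_measure ?M using \<Omega> by (rule finite_measure_lebesgue_on)
  have \<Omega>_sets: "\<Omega> \<in> sets lebesgue" using \<Omega> by (rule fmeasurableD)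
  have vs_Lpq: "vs n \<in> Lpq_space \<Omega> p q" for n using vs by (simp add: bounded_seq_def)
  have ws_Lpq: "ws n \<in> Lpq_space \<Omega> p q" for n using ws by (auto simp: equi_integrable_def)
  have [measurable]: "vs n \<in> borel_measurable ?M" "ws n \<in> borel_measurable ?M" for n
    using vs_Lpq ws_Lpq by (auto simp: Lpq_space_iff)
  obtain K where K: "\<And>n. (\<integral>x. norm (fst (vs n x)) powr p \<partial>?M) \<le> K"
      "\<And>n. (\<integral>x. norm (snd (vs n x)) powr q \<partial>?M) \<le> K"
    using vs by (auto simp: bounded_seq_def)
  have "equi_integrable_modification ?M p q vs ws (K + K)"
  proof (intro equi_integrable_modification.intro equi_integrable_modification_axioms.intro)
    show "(\<integral>x. modular p q (vs n x) \<partial>?M) \<le> K + K" for n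
      unfolding modular_def using vs_Lpq[of n] K[of n]
      by (subst Bochner_Integration.integral_add) (auto simp: Lpq_space_def Lp_space_def)
  next
    fix \<epsilon> :: real assume "0 < \<epsilon>"
    with ws have "\<exists>\<delta>>0. \<forall>E. E \<subseteq> \<Omega> \<and> E \<in> sets lebesgue \<and> measure lebesgue E < \<delta> \<longrightarrow>
        (\<forall>v\<in>range ws. (\<integral>x. modular p q (v x) \<partial>(lebesgue_on E)) < \<epsilon>)"
      unfolding equi_integrable_def modular_def by simp
    then obtain \<delta> where "0 < \<delta>" and \<delta>: "\<And>E n. E \<subseteq> \<Omega> \<Longrightarrow> E \<in> sets lebesgue \<Longrightarrow> measure lebesgue E < \<delta> \<Longrightarrow>
        (\<integral>x. modular p q (ws n x) \<partial>(lebesgue_on E)) < \<epsilon>"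
      by auto
    have "(\<integral>x. indicator A x * modular p q (ws n x) \<partial>?M) < \<epsilon>"
      if A: "A \<in> sets ?M" "measure ?M A < \<delta>" for A n
    proof -
      have A': "A \<subseteq> \<Omega>" "A \<in> sets lebesgue"
        using A(1) \<Omega>_sets by (auto simp: sets_restrict_space_iff)
      have "(\<integral>x. modular p q (ws n x) \<partial>(lebesgue_on A)) = (\<integral>x. indicator A x * modular p q (ws n x) \<partial>lebesgue)"
        using A'(2) by (subst integral_restrict_space) auto
      also have "\<dots> = (\<integral>x. indicator \<Omega> x *\<^sub>R (indicator A x * modular p q (ws n x)) \<partial>lebesgue)"
        using A'(1) by (intro Bochner_Integration.integral_cong) (auto simp: indicator_def)
      also have "\<dots> = (\<integral>x. indicator A x * modular p q (ws n x) \<partial>?M)"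
        using \<Omega>_sets by (subst integral_restrict_space) auto
      finally show ?thesis
        using \<delta>[OF A', of n] A(2) A'(1) \<Omega>_sets by (simp add: measure_restrict_space)
    qed
    with \<open>0 < \<delta>\<close> show "\<exists>\<delta>>0. \<forall>A\<in>sets ?M. measure ?M A < \<delta> \<longrightarrow>
        (\<forall>n. (\<integral>x. indicator A x * modular p q (ws n x) \<partial>?M) < \<epsilon>)" by blast
  next
    fix \<epsilon> :: real assume "0 < \<epsilon>"
    then have "(\<lambda>n. emeasure lebesgue {x\<in>\<Omega>. \<epsilon> < norm (ws n x - vs n x)}) \<longlonglongrightarrow> ennreal 0"
      using conv by (simp add: to_zero_in_measure_def)
    from tendsto_enn2real[OF this]
    show "(\<lambda>n. measure ?M {x\<in>space ?M. \<epsilon> < norm (ws n x - vs n x)}) \<longlonglongrightarrow> 0"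
      using \<Omega>_sets by (simp add: measure_restrict_space measure_def[symmetric])
  qed (use vs_Lpq ws_Lpq assms in \<open>auto simp: Lpq_space_iff intro: finite_measure_axioms\<close>)
  then show ?thesis ..
qed

text \<open>Both components of the difference inherit the integral bound from the modular, and
  convergence in measure because projections do not increase the norm.\<close>

lemma (in equi_integrable_modification) diff_weakly_to_zero:
  "\<lbrakk>g \<in> borel_measurable M; integrable M (\<lambda>x. norm (g x) powr (p / (p - 1)))\<rbrakk> \<Longrightarrow>
    (\<lambda>n. \<integral>x. g x \<bullet> fst (ws n x - vs n x) \<partial>M) \<longlonglongrightarrow> 0"
  "\<lbrakk>h \<in> borel_measurable M; integrable M (\<lambda>x. norm (h x) powr (q / (q - 1)))\<rbrakk> \<Longrightarrow>
    (\<lambda>n. \<integral>x. h x \<bullet> snd (ws n x - vs n x) \<partial>M) \<longlonglongrightarrow> 0"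
proof -
  obtain K' where K': "\<forall>\<^sub>F n in sequentially. (\<integral>x. modular p q (ws n x - vs n x) \<partial>M) \<le> K'"
    using diff_modular_bounded(2) by blast
  have meas [measurable]: "(\<lambda>x. fst (ws n x - vs n x)) \<in> borel_measurable M"
    "(\<lambda>x. snd (ws n x - vs n x)) \<in> borel_measurable M" for n
    by (intro borel_measurable_fst_snd borel_measurable_diff vs_meas ws_meas)+
  have int: "integrable M (\<lambda>x. norm (fst (ws n x - vs n x)) powr p)"
    "integrable M (\<lambda>x. norm (snd (ws n x - vs n x)) powr q)" for n
    by (rule Bochner_Integration.integrable_bound[OF diff_modular_bounded(1)[of n]];
        simp add: modular_def del: fst_diff snd_diff)+
  have bounded: "\<forall>\<^sub>F n in sequentially. (\<integral>x. norm (fst (ws n x - vs n x)) powr p \<partial>M) \<le> K'"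
    "\<forall>\<^sub>F n in sequentially. (\<integral>x. norm (snd (ws n x - vs n x)) powr q \<partial>M) \<le> K'"
    by (rule eventually_mono[OF K'], erule order_trans[rotated], rule integral_mono[OF int(1) diff_modular_bounded(1)],
        simp add: modular_def)
      (rule eventually_mono[OF K'], erule order_trans[rotated], rule integral_mono[OF int(2) diff_modular_bounded(1)],
        simp add: modular_def)
  have small: "(\<lambda>n. measure M {x\<in>space M. \<epsilon> < norm (T (ws n x - vs n x))}) \<longlonglongrightarrow> 0"
    if "0 < \<epsilon>" "\<And>z. norm (T z) \<le> norm z" for \<epsilon> and T :: "'a \<times> 'b \<Rightarrow> 'e::real_normed_vector"
  proof (rule tendsto_sandwich[OF _ _ tendsto_const conv[OF that(1)]])
    have "measure M {x\<in>space M. \<epsilon> < norm (T (ws n x - vs n x))} \<le> measure M {x\<in>space M. \<epsilon> < norm (ws n x - vs n x)}" for n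
      using that(2)[of "ws n x - vs n x" for x]
      by (intro finite_measure_mono Collect_mono) (auto intro: less_le_trans)
    then show "\<forall>\<^sub>F n in sequentially. measure M {x\<in>space M. \<epsilon> < norm (T (ws n x - vs n x))}
        \<le> measure M {x\<in>space M. \<epsilon> < norm (ws n x - vs n x)}" by simp
  qed simp
  show "(\<lambda>n. \<integral>x. g x \<bullet> fst (ws n x - vs n x) \<partial>M) \<longlonglongrightarrow> 0"
    if "g \<in> borel_measurable M" "integrable M (\<lambda>x. norm (g x) powr (p / (p - 1)))"
  proof (rule bounded_Lp_to_zero_in_measure_imp_weakly_to_zero[OF finite_measure_axioms p that(1) meas(1) that(2) int(1) bounded(1)])
    have "norm (fst z) \<le> norm z" for z :: "'a \<times> 'b"
      using norm_fst_le by (cases z) auto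
    then show "(\<lambda>n. measure M {x\<in>space M. \<epsilon> < norm (fst (ws n x - vs n x))}) \<longlonglongrightarrow> 0" if "0 < \<epsilon>" for \<epsilon>
      using that by (intro small)
  qed
  show "(\<lambda>n. \<integral>x. h x \<bullet> snd (ws n x - vs n x) \<partial>M) \<longlonglongrightarrow> 0"
    if "h \<in> borel_measurable M" "integrable M (\<lambda>x. norm (h x) powr (q / (q - 1)))"
  proof (rule bounded_Lp_to_zero_in_measure_imp_weakly_to_zero[OF finite_measure_axioms q that(1) meas(2) that(2) int(2) bounded(2)])
    have "norm (snd z) \<le> norm z" for z :: "'a \<times> 'b"
      using norm_snd_le by (cases z) auto
    then show "(\<lambda>n. measure M {x\<in>space M. \<epsilon> < norm (snd (ws n x - vs n x))}) \<longlonglongrightarrow> 0" if "0 < \<epsilon>" for \<epsilon>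
      using that by (intro small)
  qed
qed

lemma weak_conv_modification:
  fixes vs ws :: "nat \<Rightarrow> 'd::euclidean_space \<Rightarrow> 'a::euclidean_space \<times> 'b::euclidean_space"
  assumes "equi_integrable_modification (lebesgue_on \<Omega>) p q vs ws K" and vs: "weak_conv \<Omega> p q vs v"
  shows "weak_conv \<Omega> p q ws v"
proof -
  let ?M = "lebesgue_on \<Omega>"
  interpret equi_integrable_modification ?M p q vs ws K by fact
  have Lpq: "vs n \<in> Lpq_space \<Omega> p q" "ws n \<in> Lpq_space \<Omega> p q" for n
    using vs_int ws_int by (auto simp: Lpq_space_iff)
  have "(\<lambda>n. \<integral>x. g1 x \<bullet> fst (ws n x) + g2 x \<bullet> snd (ws n x) \<partial>?M)
      \<longlonglongrightarrow> (\<integral>x. g1 x \<bullet> fst (v x) + g2 x \<bullet> snd (v x) \<partial>?M)"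
    if g: "g1 \<in> Lp_space \<Omega> (p / (p - 1))" "g2 \<in> Lp_space \<Omega> (q / (q - 1))" for g1 g2
  proof -
    let ?I = "\<lambda>v. \<integral>x. g1 x \<bullet> fst (v x) + g2 x \<bullet> snd (v x) \<partial>?M"
    have int: "integrable ?M (\<lambda>x. g1 x \<bullet> fst (u x))" "integrable ?M (\<lambda>x. g2 x \<bullet> snd (u x))"
      if "u \<in> Lpq_space \<Omega> p q" for u :: "'d \<Rightarrow> 'a \<times> 'b"
      using g that by (auto simp: Lpq_space_def Lp_space_def
          intro: integrable_inner_conjugate(2)[OF p] integrable_inner_conjugate(2)[OF q])
    have "?I (ws n) = ?I (vs n) + ((\<integral>x. g1 x \<bullet> fst (ws n x - vs n x) \<partial>?M) + (\<integral>x. g2 x \<bullet> snd (ws n x - vs n x) \<partial>?M))" for n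
      using int[OF Lpq(1)] int[OF Lpq(2)] by (simp add: inner_diff_right)
    moreover have "(\<lambda>n. ?I (vs n) + ((\<integral>x. g1 x \<bullet> fst (ws n x - vs n x) \<partial>?M)
        + (\<integral>x. g2 x \<bullet> snd (ws n x - vs n x) \<partial>?M))) \<longlonglongrightarrow> ?I v + (0 + 0)"
      using g vs by (intro tendsto_add diff_weakly_to_zero) (auto simp: weak_conv_iff Lp_space_def)
    ultimately show ?thesis by simp
  qed
  with Lpq vs show ?thesis by (simp add: weak_conv_iff)
qed

section \<open>Growth and continuity bounds valid for all arguments outside one null set\<close>

lemma caratheodory_AE_growth:
  assumes "caratheodory \<Omega> g" "\<Omega> \<in> sets lebesgue" "0 < p" "0 < q"
    and "\<And>z. AE x in lebesgue_on \<Omega>. 0 \<le> g x z \<and> g x z \<le> C * (1 + norm (fst z) powr p + norm (snd z) powr q)"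
  shows "AE x in lebesgue_on \<Omega>. \<forall>z. 0 \<le> g x z \<and> g x z \<le> C * (1 + modular p q z)"
proof -
  have cont: "continuous_on UNIV (g x)" if "x \<in> space (lebesgue_on \<Omega>)" for x
    using assms(1,2) that by (auto simp: caratheodory_def)
  have "AE x in lebesgue_on \<Omega>. \<forall>z\<in>UNIV. 0 \<le> g x z"
    by (rule AE_ball_open_of_continuous) (use assms(5) cont in \<open>auto elim!: eventually_mono\<close>)
  moreover have "AE x in lebesgue_on \<Omega>. \<forall>z\<in>UNIV. 0 \<le> C * (1 + modular p q z) - g x z"
  proof (rule AE_ball_open_of_continuous)
    show "AE x in lebesgue_on \<Omega>. 0 \<le> C * (1 + modular p q z) - g x z" for z
      using assms(5)[of z] by eventually_elim (simp add: modular_def add.assoc)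
    show "continuous_on UNIV (\<lambda>z. C * (1 + modular p q z) - g x z)" if "x \<in> space (lebesgue_on \<Omega>)" for x
      unfolding modular_def using assms cont[OF that]
      by (intro continuous_intros continuous_on_powr') auto
  qed simp
  ultimately show ?thesis by eventually_elim auto
qed

text \<open>The null sets are merged over pairs of arguments. The bound
  \<open>\<nu> (norm (z - z'))\<close> need not vary continuously with the pair, so it could not be
  carried over from a dense set; the constant \<open>\<omega>\<close> can. The strict inequalities
  on the norms and the distance make the admissible pairs an open set.\<close>

lemma caratheodory_AE_modulus:
  fixes g :: "'d::euclidean_space \<Rightarrow> 'c::euclidean_space \<Rightarrow> real"
  assumes "caratheodory \<Omega> g" "\<Omega> \<in> sets lebesgue"
    and \<nu>: "\<And>z z'. norm z \<le> R \<Longrightarrow> norm z' \<le> R \<Longrightarrow>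
      AE x in lebesgue_on \<Omega>. \<bar>g x z - g x z'\<bar> \<le> \<nu> (norm (z - z'))"
    and \<omega>: "0 < \<omega>" "\<And>s. 0 < s \<Longrightarrow> s < \<delta> \<Longrightarrow> \<nu> s < \<omega>"
  shows "AE x in lebesgue_on \<Omega>. \<forall>z z'. norm z < R \<longrightarrow> norm z' < R \<longrightarrow> norm (z - z') < \<delta> \<longrightarrow> \<bar>g x z - g x z'\<bar> \<le> \<omega>"
proof -
  let ?U = "{y :: 'c \<times> 'c. norm (fst y) < R \<and> norm (snd y) < R \<and> norm (fst y - snd y) < \<delta>}"
  have "AE x in lebesgue_on \<Omega>. \<forall>y\<in>?U. 0 \<le> \<omega> - \<bar>g x (fst y) - g x (snd y)\<bar>"
  proof (rule AE_ball_open_of_continuous)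
    show "open ?U"
      by (intro open_Collect_conj open_Collect_less continuous_intros)
    show "AE x in lebesgue_on \<Omega>. 0 \<le> \<omega> - \<bar>g x (fst y) - g x (snd y)\<bar>" if "y \<in> ?U" for y
    \<comment> \<open>Smallness of \<open>\<nu>\<close> is assumed only at positive distances, so
      the diagonal is treated apart; the difference vanishes there.\<close>
    proof (cases "fst y = snd y")
      case False
      then have "\<nu> (norm (fst y - snd y)) < \<omega>" using that by (intro \<omega>) auto
      moreover have "AE x in lebesgue_on \<Omega>. \<bar>g x (fst y) - g x (snd y)\<bar> \<le> \<nu> (norm (fst y - snd y))"
        using that by (intro \<nu>) auto
      ultimately show ?thesis by (auto elim!: eventually_mono)
    qed (use \<omega> in simp)
    show "continuous_on UNIV (\<lambda>y. \<omega> - \<bar>g x (fst y) - g x (snd y)\<bar>)" if "x \<in> space (lebesgue_on \<Omega>)" for x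
    proof -
      have "continuous_on UNIV (g x)" using assms(1,2) that by (auto simp: caratheodory_def)
      then have "continuous_on UNIV (\<lambda>y. g x (fst y))" "continuous_on UNIV (\<lambda>y. g x (snd y))"
        by (rule continuous_on_compose2; auto intro: continuous_intros)+
      then show ?thesis by (intro continuous_intros)
    qed
  qed
  then show ?thesis by eventually_elim auto
qed

lemma limsup_le_of_eventually_le:
  fixes a b :: "nat \<Rightarrow> real"
  assumes le: "\<And>\<epsilon>. 0 < \<epsilon> \<Longrightarrow> \<forall>\<^sub>F n in sequentially. a n \<le> b n + \<epsilon>"
    and lim: "(\<lambda>n. ereal (b n)) \<longlonglongrightarrow> L"
  shows "limsup (\<lambda>n. ereal (a n)) \<le> L"
proof (rule ereal_le_epsilon2)
  fix \<epsilon> :: real assume "0 < \<epsilon>"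
    have "limsup (\<lambda>n. ereal (a n)) \<le> limsup (\<lambda>n. ereal (b n) + ereal \<epsilon>)"
      using le[OF \<open>0 < \<epsilon>\<close>] by (intro Limsup_mono) (auto elim!: eventually_mono)
    also have "\<dots> = L + ereal \<epsilon>"
      using lim_imp_Limsup[OF _ lim] by (subst Limsup_add_ereal_right) auto
    finally show "limsup (\<lambda>n. ereal (a n)) \<le> L + ereal \<epsilon>" .
qed

subsection \<open>Variational limits\<close>

theorem theorem3p6:
  fixes \<Omega> :: "'d::euclidean_space set"
    and p q :: real
    and X :: "('d \<Rightarrow> 'a::euclidean_space \<times> 'b::euclidean_space) set"
    and f :: "'d \<Rightarrow> 'a \<times> 'b \<Rightarrow> real"
    and fn :: "nat \<Rightarrow> 'd \<Rightarrow> 'a \<times> 'b \<Rightarrow> real"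
  assumes "open \<Omega>" and "bounded \<Omega>"
    and "1 < p" and "1 < q"
    and "X \<subseteq> Lpq_space \<Omega> p q" and "weakly_closed \<Omega> p q X"
    and "caratheodory \<Omega> f" and "\<And>n. caratheodory \<Omega> (fn n)"
    and H1: "\<And>vs. bounded_seq \<Omega> p q vs \<Longrightarrow> (\<forall>n. vs n \<in> X) \<Longrightarrow>
      \<exists>ws. (\<forall>n. ws n \<in> X) \<and> equi_integrable \<Omega> p q (range ws) \<and>
           to_zero_in_measure \<Omega> (\<lambda>n x. ws n x - vs n x)"
    and H2: "\<exists>C>0. \<forall>n z. AE x in lebesgue_on \<Omega>.
      0 \<le> fn n x z \<and> fn n x z \<le> C * (1 + norm (fst z) powr p + norm (snd z) powr q) \<and>
      0 \<le> f x z \<and> f x z \<le> C * (1 + norm (fst z) powr p + norm (snd z) powr q)"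
    and H3: "\<forall>R>0. \<exists>\<nu> :: real \<Rightarrow> real. mono_on {0..} \<nu> \<and> (\<nu> \<longlongrightarrow> 0) (at_right 0) \<and>
      (\<forall>n z z'. norm z \<le> R \<and> norm z' \<le> R \<longrightarrow> (AE x in lebesgue_on \<Omega>.
         \<bar>fn n x z - fn n x z'\<bar> + \<bar>f x z - f x z'\<bar> \<le> \<nu> (norm (z - z'))))"
    and H4: "\<And>B \<epsilon>. equi_integrable \<Omega> p q B \<Longrightarrow> \<epsilon> > 0 \<Longrightarrow>
      \<exists>N. \<forall>n\<ge>N. \<forall>v\<in>B. \<bar>\<integral>x. fn n x (v x) - f x (v x) \<partial>(lebesgue_on \<Omega>)\<bar> \<le> \<epsilon>"
  shows "(\<forall>vs v. (\<forall>n. vs n \<in> X) \<and> weak_conv \<Omega> p q vs v \<longrightarrow>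
            (\<exists>ws. (\<forall>n. ws n \<in> X) \<and> weak_conv \<Omega> p q ws v \<and>
               limsup (\<lambda>n. IX \<Omega> (fn n) X (ws n)) \<le> liminf (\<lambda>n. IX \<Omega> f X (vs n))))
       \<and> (\<forall>vs v. (\<forall>n. vs n \<in> X) \<and> weak_conv \<Omega> p q vs v \<longrightarrow>
            (\<exists>ws. (\<forall>n. ws n \<in> X) \<and> weak_conv \<Omega> p q ws v \<and>
               limsup (\<lambda>n. IX \<Omega> f X (ws n)) \<le> liminf (\<lambda>n. IX \<Omega> (fn n) X (vs n))))
       \<and> (\<forall>G. gamma_limit \<Omega> p q (\<lambda>_. IX \<Omega> f X) G \<longrightarrow>
              gamma_limit \<Omega> p q (\<lambda>n. IX \<Omega> (fn n) X) G)"
proof -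
  let ?M = "lebesgue_on \<Omega>"
  have \<Omega>: "\<Omega> \<in> lmeasurable" using assms(1,2) by (simp add: lmeasurable_open)
  then have \<Omega>_sets: "\<Omega> \<in> sets lebesgue" by (rule fmeasurableD)
  have p: "1 < p" and q: "1 < q" by fact+
  have X: "v \<in> Lpq_space \<Omega> p q" if "v \<in> X" for v using assms(5) that by blast
  \<comment> \<open>Membership in this family of integrands is all that the estimates need, so the
    same comparison applies to the constant family \<open>f\<close> and to any reindexing of
    \<open>fn\<close>.\<close>
  define c where "c g \<longleftrightarrow> g = f \<or> g \<in> range fn" for g
  have c_f: "c f" and c_fn: "c (fn n)" for n by (auto simp: c_def)
  have cara: "caratheodory \<Omega> g" if "c g" for g using assms(7,8) that by (auto simp: c_def)
  have meas: "(\<lambda>x. g x (u x)) \<in> borel_measurable ?M" if "c g" "u \<in> borel_measurable ?M" for g u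
    by (rule borel_measurable_caratheodory_compose[OF _ _ that(2)]) (use cara[OF that(1)] in \<open>auto simp: caratheodory_def\<close>)
  obtain C where "0 < C" and growth: "\<And>g. c g \<Longrightarrow> AE x in ?M. \<forall>z. 0 \<le> g x z \<and> g x z \<le> C * (1 + modular p q z)"
  proof -
    obtain C where "0 < C" and C: "\<And>n z. AE x in ?M.
        0 \<le> fn n x z \<and> fn n x z \<le> C * (1 + norm (fst z) powr p + norm (snd z) powr q) \<and>
        0 \<le> f x z \<and> f x z \<le> C * (1 + norm (fst z) powr p + norm (snd z) powr q)"
      using H2 by blast
    have "AE x in ?M. 0 \<le> g x z \<and> g x z \<le> C * (1 + norm (fst z) powr p + norm (snd z) powr q)" if "c g" for g z
      using that unfolding c_def
    proof
      assume "g = f"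
      with C[of 0 z] show ?thesis by auto
    next
      assume "g \<in> range fn"
      then obtain n where "g = fn n" by blast
      with C[of n z] show ?thesis by auto
    qed
    then have "AE x in ?M. \<forall>z. 0 \<le> g x z \<and> g x z \<le> C * (1 + modular p q z)" if "c g" for g
      using that cara p q \<Omega>_sets by (intro caratheodory_AE_growth) auto
    with \<open>0 < C\<close> show ?thesis by (rule that)
  qed
  have modulus: "\<exists>\<delta>>0. \<forall>g. c g \<longrightarrow> (AE x in ?M. \<forall>z z'. norm z < R \<longrightarrow> norm z' < R \<longrightarrow>
      norm (z - z') < \<delta> \<longrightarrow> \<bar>g x z - g x z'\<bar> \<le> \<omega>)" if "0 < R" "0 < \<omega>" for R \<omega>
  proof -
    obtain \<nu> :: "real \<Rightarrow> real" where lim: "(\<nu> \<longlongrightarrow> 0) (at_right 0)" and \<nu>: "\<And>n z z'. norm z \<le> R \<Longrightarrow> norm z' \<le> R \<Longrightarrow>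
        AE x in ?M. \<bar>fn n x z - fn n x z'\<bar> + \<bar>f x z - f x z'\<bar> \<le> \<nu> (norm (z - z'))"
      using H3 \<open>0 < R\<close> by meson
    have \<nu>_g: "AE x in ?M. \<bar>g x z - g x z'\<bar> \<le> \<nu> (norm (z - z'))" if "norm z \<le> R" "norm z' \<le> R" "c g" for g z z'
      using that(3) unfolding c_def
    proof
      assume "g = f"
      with \<nu>[OF that(1,2), of 0] show ?thesis by (auto elim!: eventually_mono)
    next
      assume "g \<in> range fn"
      then obtain n where "g = fn n" by blast
      with \<nu>[OF that(1,2), of n] show ?thesis by (auto elim!: eventually_mono)
    qed
    have "\<forall>\<^sub>F s in at_right 0. \<nu> s < \<omega>" using order_tendstoD(2)[OF lim \<open>0 < \<omega>\<close>] .
    then obtain \<delta> where "0 < \<delta>" and \<delta>: "\<And>s. 0 < s \<Longrightarrow> s < \<delta> \<Longrightarrow> \<nu> s < \<omega>"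
      by (auto simp: eventually_at_right_field)
    have "AE x in ?M. \<forall>z z'. norm z < R \<longrightarrow> norm z' < R \<longrightarrow> norm (z - z') < \<delta> \<longrightarrow> \<bar>g x z - g x z'\<bar> \<le> \<omega>" if "c g" for g
      using that \<open>0 < \<omega>\<close> \<delta> \<nu>_g cara \<Omega>_sets by (intro caratheodory_AE_modulus[where \<nu> = \<nu>]) auto
    with \<open>0 < \<delta>\<close> show ?thesis by blast
  qed
  have int: "integrable ?M (\<lambda>x. g x (u x))" if "c g" "u \<in> Lpq_space \<Omega> p q" for g u
  proof (rule Bochner_Integration.integrable_bound[where f = "\<lambda>x. C * (1 + modular p q (u x))"])
    interpret finite_measure ?M using \<Omega> by (rule finite_measure_lebesgue_on)
    show "integrable ?M (\<lambda>x. C * (1 + modular p q (u x)))" using that(2) by (simp add: Lpq_space_iff)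
    show "(\<lambda>x. g x (u x)) \<in> borel_measurable ?M" using that by (intro meas) (auto simp: Lpq_space_iff)
    show "AE x in ?M. norm (g x (u x)) \<le> norm (C * (1 + modular p q (u x)))"
      using growth[OF that(1)]
    proof eventually_elim
      case (elim x)
      then have "0 \<le> g x (u x)" "g x (u x) \<le> C * (1 + modular p q (u x))" by blast+
      then show ?case by simp
    qed
  qed

  \<comment> \<open>One modified sequence serves both directions. In applications \<open>vs\<close>
    is already a subsequence: the first estimate keeps the original index \<open>r n\<close> of the
    integrand, while the second renumbers it to \<open>n\<close>, which is possible because
    \<open>f\<close> carries no index.\<close>
  have modification: "\<exists>ws. (\<forall>n. ws n \<in> X) \<and> weak_conv \<Omega> p q ws v \<and>
      (\<forall>\<epsilon>>0. \<forall>\<^sub>F n in sequentially. (\<integral>x. f x (ws n x) \<partial>?M) \<le> (\<integral>x. fn (r n) x (vs n x) \<partial>?M) + \<epsilon>) \<and>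
      (\<forall>\<epsilon>>0. \<forall>\<^sub>F n in sequentially. (\<integral>x. fn n x (ws n x) \<partial>?M) \<le> (\<integral>x. f x (vs n x) \<partial>?M) + \<epsilon>)"
    if r: "strict_mono r" and vs: "\<And>n. vs n \<in> X" "weak_conv \<Omega> p q vs v" for r :: "nat \<Rightarrow> nat" and vs v
  proof -
    have bounded: "bounded_seq \<Omega> p q vs" using vs(2) p q by (rule weak_conv_imp_bounded_seq)
    with H1 vs(1) obtain ws where ws: "\<And>n. ws n \<in> X" "equi_integrable \<Omega> p q (range ws)"
      "to_zero_in_measure \<Omega> (\<lambda>n x. ws n x - vs n x)" by blast
    obtain K where K: "equi_integrable_modification ?M p q vs ws K"
      using equi_integrable_modificationI[OF \<Omega> p q bounded ws(2,3)] by blast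
    interpret equi_integrable_modification ?M p q vs ws K by (rule K)
    have le: "\<forall>\<^sub>F n in sequentially. (\<integral>x. g n x (ws n x) \<partial>?M) \<le> (\<integral>x. g n x (vs n x) \<partial>?M) + \<epsilon>"
      if "\<And>n. c (g n)" "0 < \<epsilon>" for g \<epsilon>
    proof (rule eventually_integral_le[OF meas \<open>0 < C\<close> growth])
      show "\<exists>\<delta>>0. \<forall>n. AE x in ?M. \<forall>z z'. norm z < R \<longrightarrow> norm z' < R \<longrightarrow> norm (z - z') < \<delta> \<longrightarrow>
          \<bar>g n x z - g n x z'\<bar> \<le> \<omega>" if "0 < R" "0 < \<omega>" for R \<omega>
        using modulus[OF that] \<open>\<And>n. c (g n)\<close> by blast
    qed (use that in auto)
    \<comment> \<open>The set in (H4) is the whole range of \<open>ws\<close>, hence the separate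
      quantifier over \<open>k\<close>. In particular \<open>fn (r n)\<close> may be compared with
      \<open>f\<close> at \<open>ws n\<close>, as \<open>r n\<close> is at least
      \<open>n\<close>.\<close>
    have H4': "\<exists>N. \<forall>n\<ge>N. \<forall>k. \<bar>(\<integral>x. fn n x (ws k x) \<partial>?M) - (\<integral>x. f x (ws k x) \<partial>?M)\<bar> \<le> \<epsilon>" if "0 < \<epsilon>" for \<epsilon>
    proof -
      have "(\<integral>x. fn n x (ws k x) - f x (ws k x) \<partial>?M) = (\<integral>x. fn n x (ws k x) \<partial>?M) - (\<integral>x. f x (ws k x) \<partial>?M)" for n k
        using int[OF c_fn X[OF ws(1)]] int[OF c_f X[OF ws(1)]] by (rule Bochner_Integration.integral_diff)
      with H4[OF ws(2) that] show ?thesis by simp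
    qed
    have "\<forall>\<^sub>F n in sequentially. (\<integral>x. f x (ws n x) \<partial>?M) \<le> (\<integral>x. fn (r n) x (vs n x) \<partial>?M) + \<epsilon>" if "0 < \<epsilon>" for \<epsilon>
    proof -
      have pos: "0 < \<epsilon> / 2" using that by simp
      obtain N where N: "\<And>n k. N \<le> n \<Longrightarrow> \<bar>(\<integral>x. fn n x (ws k x) \<partial>?M) - (\<integral>x. f x (ws k x) \<partial>?M)\<bar> \<le> \<epsilon> / 2"
        using H4'[OF pos] by blast
      show ?thesis
        using le[of "\<lambda>n. fn (r n)" "\<epsilon> / 2", OF c_fn pos] eventually_ge_at_top[of N]
      proof eventually_elim
        case (elim n)
        then show ?case using N[of "r n" n] seq_suble[OF r, of n] unfolding abs_le_iff by linarith
      qed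
    qed
    moreover have "\<forall>\<^sub>F n in sequentially. (\<integral>x. fn n x (ws n x) \<partial>?M) \<le> (\<integral>x. f x (vs n x) \<partial>?M) + \<epsilon>" if "0 < \<epsilon>" for \<epsilon>
    proof -
      have pos: "0 < \<epsilon> / 2" using that by simp
      obtain N where N: "\<And>n k. N \<le> n \<Longrightarrow> \<bar>(\<integral>x. fn n x (ws k x) \<partial>?M) - (\<integral>x. f x (ws k x) \<partial>?M)\<bar> \<le> \<epsilon> / 2"
        using H4'[OF pos] by blast
      show ?thesis
        using le[of "\<lambda>n. f" "\<epsilon> / 2", OF c_f pos] eventually_ge_at_top[of N]
      proof eventually_elim
        case (elim n)
        then show ?case using N[of n n] unfolding abs_le_iff by linarith
      qed
    qed
    ultimately show ?thesis using ws(1) weak_conv_modification[OF K vs(2)] by blast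
  qed

  \<comment> \<open>The map \<open>r\<close> is the identity for (ii). The liminf inequality in
    (iii) needs genuine subsequences, since only along one is \<open>vs\<close> known to lie in
    \<open>X\<close>.\<close>
  have lower: "\<exists>ws. (\<forall>n. ws n \<in> X) \<and> weak_conv \<Omega> p q ws v \<and>
      limsup (\<lambda>n. IX \<Omega> f X (ws n)) \<le> liminf (\<lambda>n. IX \<Omega> (fn (r n)) X (vs n))"
    if r: "strict_mono r" and vs: "\<And>n. vs n \<in> X" "weak_conv \<Omega> p q vs v" for r :: "nat \<Rightarrow> nat" and vs v
  proof -
    obtain s where s: "strict_mono s"
      "((\<lambda>n. IX \<Omega> (fn (r n)) X (vs n)) \<circ> s) \<longlonglongrightarrow> liminf (\<lambda>n. IX \<Omega> (fn (r n)) X (vs n))"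
      using liminf_subseq_lim by blast
    from modification[of "r \<circ> s" "\<lambda>n. vs (s n)" v, OF strict_mono_o[OF r s(1)] vs(1) weak_conv_subseq[OF vs(2) s(1)]]
    obtain ws where ws: "\<And>n. ws n \<in> X" "weak_conv \<Omega> p q ws v"
      and le: "\<And>\<epsilon>. 0 < \<epsilon> \<Longrightarrow> \<forall>\<^sub>F n in sequentially. (\<integral>x. f x (ws n x) \<partial>?M) \<le> (\<integral>x. fn (r (s n)) x (vs (s n) x) \<partial>?M) + \<epsilon>"
      by (auto simp: o_def)
    have "limsup (\<lambda>n. ereal (\<integral>x. f x (ws n x) \<partial>?M)) \<le> liminf (\<lambda>n. IX \<Omega> (fn (r n)) X (vs n))"
      by (rule limsup_le_of_eventually_le[OF le]) (use s(2) vs(1) in \<open>simp_all add: IX_def o_def\<close>)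
    then show ?thesis using ws by (intro exI[of _ ws]) (simp add: IX_def)
  qed

  have upper: "\<exists>ws. (\<forall>n. ws n \<in> X) \<and> weak_conv \<Omega> p q ws v \<and>
      limsup (\<lambda>n. IX \<Omega> (fn n) X (ws n)) \<le> liminf (\<lambda>n. IX \<Omega> f X (vs n))"
    if vs: "\<And>n. vs n \<in> X" "weak_conv \<Omega> p q vs v" for vs v
  proof -
    obtain s where s: "strict_mono s" "((\<lambda>n. IX \<Omega> f X (vs n)) \<circ> s) \<longlonglongrightarrow> liminf (\<lambda>n. IX \<Omega> f X (vs n))"
      using liminf_subseq_lim by blast
    \<comment> \<open>Here \<open>ws n\<close> comes from \<open>vs (s n)\<close> but is paired with
      \<open>fn n\<close>, so the limsup over all indices is compared with the limit attained along
      \<open>s\<close>.\<close>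
    from modification[of s "\<lambda>n. vs (s n)" v, OF s(1) vs(1) weak_conv_subseq[OF vs(2) s(1)]]
    obtain ws where ws: "\<And>n. ws n \<in> X" "weak_conv \<Omega> p q ws v"
      and le: "\<And>\<epsilon>. 0 < \<epsilon> \<Longrightarrow> \<forall>\<^sub>F n in sequentially. (\<integral>x. fn n x (ws n x) \<partial>?M) \<le> (\<integral>x. f x (vs (s n) x) \<partial>?M) + \<epsilon>"
      by blast
    have "limsup (\<lambda>n. ereal (\<integral>x. fn n x (ws n x) \<partial>?M)) \<le> liminf (\<lambda>n. IX \<Omega> f X (vs n))"
      by (rule limsup_le_of_eventually_le[OF le]) (use s(2) vs(1) in \<open>simp_all add: IX_def o_def\<close>)
    then show ?thesis using ws by (intro exI[of _ ws]) (simp add: IX_def)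
  qed

  have "gamma_limit \<Omega> p q (\<lambda>n. IX \<Omega> (fn n) X) G" if G: "gamma_limit \<Omega> p q (\<lambda>_. IX \<Omega> f X) G" for G
    unfolding gamma_limit_def
  proof (intro conjI ballI allI impI)
    fix v :: "'d \<Rightarrow> 'a \<times> 'b" and vs
    assume v: "v \<in> Lpq_space \<Omega> p q" and vs: "weak_conv \<Omega> p q vs v"
    let ?L = "liminf (\<lambda>n. IX \<Omega> (fn n) X (vs n))"
    show "G v \<le> ?L"
    proof (cases "?L = \<infinity>")
      case False
      obtain r where r: "strict_mono r" "(\<lambda>n. IX \<Omega> (fn (r n)) X (vs (r n))) \<longlonglongrightarrow> ?L"
        using liminf_subseq_lim[of "\<lambda>n. IX \<Omega> (fn n) X (vs n)"] by (auto simp: o_def)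
      have "\<forall>\<^sub>F n in sequentially. IX \<Omega> (fn (r n)) X (vs (r n)) < \<infinity>"
        using r(2) False by (intro order_tendstoD(2)) (auto simp: less_top)
      then obtain N where N: "\<And>n. N \<le> n \<Longrightarrow> vs (r n) \<in> X"
        by (auto simp: eventually_sequentially IX_def split: if_splits)
      define t where "t n = r (n + N)" for n
      have t: "strict_mono t" using r(1) by (auto simp: t_def strict_mono_def)
      obtain ws where ws: "\<And>n. ws n \<in> X" "weak_conv \<Omega> p q ws v"
        and le: "limsup (\<lambda>n. IX \<Omega> f X (ws n)) \<le> liminf (\<lambda>n. IX \<Omega> (fn (t n)) X (vs (t n)))"
        using lower[of t "\<lambda>n. vs (t n)" v, OF t _ weak_conv_subseq[OF vs t]] N by (auto simp: t_def)
      have "G v \<le> liminf (\<lambda>n. IX \<Omega> f X (ws n))" using G v ws(2) unfolding gamma_limit_def by blast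
      also have "\<dots> \<le> limsup (\<lambda>n. IX \<Omega> f X (ws n))" by (intro Liminf_le_Limsup) simp
      also note le
      also have "liminf (\<lambda>n. IX \<Omega> (fn (t n)) X (vs (t n))) = ?L"
        using LIMSEQ_ignore_initial_segment[OF r(2), of N] unfolding t_def by (intro lim_imp_Liminf) auto
      finally show ?thesis .
    qed simp
  next
    fix v :: "'d \<Rightarrow> 'a \<times> 'b" assume v: "v \<in> Lpq_space \<Omega> p q"
    then obtain vs where vs: "weak_conv \<Omega> p q vs v" "limsup (\<lambda>n. IX \<Omega> f X (vs n)) \<le> G v"
      using G unfolding gamma_limit_def by blast
    show "\<exists>ws. weak_conv \<Omega> p q ws v \<and> limsup (\<lambda>n. IX \<Omega> (fn n) X (ws n)) \<le> G v"
    proof (cases "G v = \<infinity>")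
      \<comment> \<open>Any sequence converging weakly to \<open>v\<close> is a recovery sequence
        here, so \<open>vs\<close> itself will do.\<close>
      case True
      with vs(1) show ?thesis by auto
    next
      case False
      then have "limsup (\<lambda>n. IX \<Omega> f X (vs n)) < \<infinity>" using vs(2) by (auto simp: less_top[symmetric] top_unique)
      from Limsup_lessD[OF this] obtain N where N: "\<And>n. N \<le> n \<Longrightarrow> vs n \<in> X"
        by (auto simp: eventually_sequentially IX_def split: if_splits)
      have t: "strict_mono (\<lambda>n. n + N)" by (simp add: strict_mono_def)
      obtain ws where ws: "weak_conv \<Omega> p q ws v"
        and le: "limsup (\<lambda>n. IX \<Omega> (fn n) X (ws n)) \<le> liminf (\<lambda>n. IX \<Omega> f X (vs (n + N)))"
        using upper[of "\<lambda>n. vs (n + N)" v, OF _ weak_conv_subseq[OF vs(1) t]] N by auto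
      note le
      also have "liminf (\<lambda>n. IX \<Omega> f X (vs (n + N))) \<le> limsup (\<lambda>n. IX \<Omega> f X (vs (n + N)))"
        by (intro Liminf_le_Limsup) simp
      also have "\<dots> \<le> limsup (\<lambda>n. IX \<Omega> f X (vs n))"
        using limsup_subseq_mono[OF t, of "\<lambda>n. IX \<Omega> f X (vs n)"] by (simp add: o_def)
      also note vs(2)
      finally show ?thesis using ws by blast
    qed
  qed
  moreover have "strict_mono (\<lambda>n::nat. n)" by (simp add: strict_mono_def)
  ultimately show ?thesis using upper lower[of "\<lambda>n. n"] by blast
qed

end
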